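(* Let $\mathcal{C}$ be a strict braided monoidal category and let $H\colon\mathbb{Z}\to\mathcal{C}$ be a Hopf f-object, with product $\nabla$, unit $\eta$, coproduct $\Delta$, counit $\epsilon$, invertible antipode $S$, and automorphism $\phi_H\colon H\to H$. Let $\tau$ be the braiding of $\mathcal{C}^{\mathbb{Z}}$ and put $\nabla^{(2)}=\nabla(\nabla\otimes\operatorname{id}_H)$, $\Delta^{(2)}=(\Delta\otimes\operatorname{id}_H)\Delta$. Then: (a) the triple $(H,\nabla,\delta_L)$ is a left Yetter--Drinfel'd f-object over $H$, where $$\delta_L:=(\nabla\otimes\operatorname{id}_H)(\operatorname{id}_H\otimes\tau_{H,H})(\operatorname{id}_{H\otimes H}\otimes S\phi_H)\Delta^{(2)};$$ (b) the triple $(H,\lambda_R,\Delta)$ is a right Yetter--Drinfel'd f-object over $H$, where $$\lambda_R:=\nabla^{(2)}(S\phi_H\otimes\operatorname{id}_{H\otimes H})(\tau_{H,H}\otimes\operatorname{id}_H)(\operatorname{id}_H\otimes\Delta).$$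
   Context: Conventions: all monoidal categories are strict; composition of morphisms is written by juxtaposition, $fg=f\circ g$, and composition takes precedence over $\otimes$, so $fg\otimes h=(fg)\otimes h$. The category $\mathcal{C}^{\mathbb{Z}}$: the group $\mathbb{Z}$ is viewed as a category with one object $*$ with automorphism group $\mathbb{Z}$; $\mathcal{C}^{\mathbb{Z}}$ is the category of functors $\mathbb{Z}\to\mathcal{C}$ (called f-objects) and natural transformations. Equivalently, an f-object $F$ is a pair $(A,\phi)$ with $A=F( * )$ an object of $\mathcal{C}$ and $\phi=F(1)\in\operatorname{Aut}(A)$; a morphism $(A,\phi)\to(B,\psi)$ is a morphism $f\colon A\to B$ in $\mathcal{C}$ with $\psi f=f\phi$; and $(A,\phi)\otimes(B,\psi)=(A\otimes B,\phi\otimes\psi)$. The unit object is $\mathbb{I}=(I,\operatorname{id}_I)$ with $I$ the unit of $\mathcal{C}$. The category $\mathcal{C}^{\mathbb{Z}}$ is braided monoidal, with braiding $\tau_{F,G}\colon F\otimes G\to G\otimes F$ given by the braiding of $\mathcal{C}$ on the underlying objects. For an f-object $F$, $\phi_F\colon F\to F$ denotes the isomorphism in $\mathcal{C}^{\mathbb{Z}}$ whose value at $*$ is $F(1)$. Hopf f-object: an f-object $H$ with morphisms in $\mathcal{C}^{\mathbb{Z}}$: $\nabla\colon H\otimes H\to H$, $\eta\colon\mathbb{I}\to H$, $\Delta\colon H\to H\otimes H$, $\epsilon\colon H\to\mathbb{I}$, $S\colon H\to H$, such that $(H,\nabla,\eta)$ is an (associative unital) algebra object, $(H,\Delta,\epsilon)$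 is a (coassociative counital) coalgebra object, $$(\nabla\otimes\nabla)(\operatorname{id}_H\otimes\tau_{H,H}\otimes\operatorname{id}_H)(\Delta\otimes\Delta)=\Delta\nabla,\qquad \nabla(S\otimes\operatorname{id}_H)\Delta=\eta\epsilon=\nabla(\operatorname{id}_H\otimes S)\Delta,$$ and $S$ is always assumed invertible. (As usual for a Hopf object, $\eta$ is a coalgebra morphism and $\epsilon$ is an algebra morphism.) Left Yetter--Drinfel'd f-object over $H$: a triple $(Y,\lambda_L,\delta_L)$ with $Y$ an f-object and $\lambda_L\colon H\otimes Y\to Y$, $\delta_L\colon Y\to H\otimes Y$ morphisms of $\mathcal{C}^{\mathbb{Z}}$ such that $(Y,\lambda_L)$ is a left $H$-module, $(Y,\delta_L)$ is a left $H$-comodule, and $$(\nabla\otimes\operatorname{id}_Y)(\operatorname{id}_H\otimes\tau_{Y,H})(\delta_L\lambda_L\otimes\phi_H)(\operatorname{id}_H\otimes\tau_{H,Y})(\Delta\otimes\operatorname{id}_Y)=(\nabla\otimes\lambda_L)(\operatorname{id}_H\otimes\tau_{H,H}\otimes\operatorname{id}_Y)(\Delta\otimes\delta_L).$$ Right Yetter--Drinfel'd f-object over $H$: a triple $(Y,\lambda_R,\delta_R)$ with $Y$ an f-object and $\lambda_R\colon Y\otimes H\to Y$, $\delta_R\colon Y\to Y\otimes H$ morphisms of $\mathcal{C}^{\mathbb{Z}}$ such that $(Y,\lambda_R)$ is a right $H$-module, $(Y,\delta_R)$ is a right $H$-comodule, and $$(\operatorname{id}_Y\otimes\nabla)(\tau_{H,Y}\otimes\operatorname{id}_H)(\phi_H\otimes\delta_R\lambda_R)(\tau_{Y,H}\otimes\operatorname{id}_H)(\operatorname{id}_Y\otimes\Delta)=(\lambda_R\otimes\nabla)(\operatorname{id}_Y\otimes\tau_{H,H}\otimes\operatorname{id}_H)(\delta_R\otimes\Delta).$$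 *)

theory Defs
  imports Main
begin

text \<open>
  Raw data of a strict braided monoidal category. A morphism is an element of a type
  \<open>'m\<close> that lies in a hom-set \<open>Hom C A B\<close>; hom-sets need not be disjoint, so that in the
  functor category below a morphism can literally be its underlying morphism of \<open>C\<close>.
  As in juxtaposition notation, composition \<open>\<cdot>\<close> binds tighter than \<open>\<otimes>\<close>.
\<close>

record ('o, 'm) bmcat =
  Ob :: "'o set"
  Hom :: "'o \<Rightarrow> 'o \<Rightarrow> 'm set"
  ident :: "'o \<Rightarrow> 'm"  ("\<one>\<index>")
  comp :: "'m \<Rightarrow> 'm \<Rightarrow> 'm"  (infixr "\<cdot>\<index>" 75)
  unit_ob :: "'o"  ("\<I>\<index>")
  tensor_ob :: "'o \<Rightarrow> 'o \<Rightarrow> 'o"  (infixr "\<odot>\<index>" 70)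
  tensor :: "'m \<Rightarrow> 'm \<Rightarrow> 'm"  (infixr "\<otimes>\<index>" 70)
  braiding :: "'o \<Rightarrow> 'o \<Rightarrow> 'm"  ("\<tau>\<index>")

definition iso_arrow :: "('o, 'm) bmcat \<Rightarrow> 'o \<Rightarrow> 'o \<Rightarrow> 'm \<Rightarrow> bool" where
  "iso_arrow C A B f \<longleftrightarrow> f \<in> Hom C A B \<and>
     (\<exists>g \<in> Hom C B A. g \<cdot>\<^bsub>C\<^esub> f = \<one>\<^bsub>C\<^esub> A \<and> f \<cdot>\<^bsub>C\<^esub> g = \<one>\<^bsub>C\<^esub> B)"

locale strict_braided_monoidal_category =
  fixes C :: "('o, 'm) bmcat" (structure)
  assumes hom_ob: "f \<in> Hom C A B \<Longrightarrow> A \<in> Ob C \<and> B \<in> Ob C"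
    and ident_hom: "A \<in> Ob C \<Longrightarrow> \<one> A \<in> Hom C A A"
    and comp_hom: "g \<in> Hom C B D \<Longrightarrow> f \<in> Hom C A B \<Longrightarrow> g \<cdot> f \<in> Hom C A D"
    and comp_assoc: "h \<in> Hom C D E \<Longrightarrow> g \<in> Hom C B D \<Longrightarrow> f \<in> Hom C A B \<Longrightarrow>
          (h \<cdot> g) \<cdot> f = h \<cdot> (g \<cdot> f)"
    and ident_left: "f \<in> Hom C A B \<Longrightarrow> \<one> B \<cdot> f = f"
    and ident_right: "f \<in> Hom C A B \<Longrightarrow> f \<cdot> \<one> A = f"
    and unit_ob: "\<I> \<in> Ob C"
    and tensor_ob: "A \<in> Ob C \<Longrightarrow> B \<in> Ob C \<Longrightarrow> A \<odot> B \<in> Ob C"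
    and tensor_hom: "f \<in> Hom C A B \<Longrightarrow> g \<in> Hom C D E \<Longrightarrow> f \<otimes> g \<in> Hom C (A \<odot> D) (B \<odot> E)"
    and tensor_ident: "A \<in> Ob C \<Longrightarrow> B \<in> Ob C \<Longrightarrow> \<one> A \<otimes> \<one> B = \<one> (A \<odot> B)"
    and interchange: "f \<in> Hom C A B \<Longrightarrow> f' \<in> Hom C B D \<Longrightarrow>
          g \<in> Hom C A' B' \<Longrightarrow> g' \<in> Hom C B' D' \<Longrightarrow>
          (f' \<otimes> g') \<cdot> (f \<otimes> g) = f' \<cdot> f \<otimes> g' \<cdot> g"
    and tensor_ob_assoc: "A \<in> Ob C \<Longrightarrow> B \<in> Ob C \<Longrightarrow> D \<in> Ob C \<Longrightarrow>
          (A \<odot> B) \<odot> D = A \<odot> (B \<odot> D)"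
    and tensor_ob_unit: "A \<in> Ob C \<Longrightarrow> \<I> \<odot> A = A \<and> A \<odot> \<I> = A"
    and tensor_assoc: "f \<in> Hom C A A' \<Longrightarrow> g \<in> Hom C B B' \<Longrightarrow> h \<in> Hom C D D' \<Longrightarrow>
          (f \<otimes> g) \<otimes> h = f \<otimes> (g \<otimes> h)"
    and tensor_unit: "f \<in> Hom C A B \<Longrightarrow> \<one> \<I> \<otimes> f = f \<and> f \<otimes> \<one> \<I> = f"
    and braiding_iso: "A \<in> Ob C \<Longrightarrow> B \<in> Ob C \<Longrightarrow> iso_arrow C (A \<odot> B) (B \<odot> A) (\<tau> A B)"
    and braiding_natural: "f \<in> Hom C A A' \<Longrightarrow> g \<in> Hom C B B' \<Longrightarrow>
          \<tau> A' B' \<cdot> (f \<otimes> g) = (g \<otimes> f) \<cdot> \<tau> A B"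
    and hexagon_left: "A \<in> Ob C \<Longrightarrow> B \<in> Ob C \<Longrightarrow> D \<in> Ob C \<Longrightarrow>
          \<tau> (A \<odot> B) D = (\<tau> A D \<otimes> \<one> B) \<cdot> (\<one> A \<otimes> \<tau> B D)"
    and hexagon_right: "A \<in> Ob C \<Longrightarrow> B \<in> Ob C \<Longrightarrow> D \<in> Ob C \<Longrightarrow>
          \<tau> A (B \<odot> D) = (\<one> B \<otimes> \<tau> A D) \<cdot> (\<tau> A B \<otimes> \<one> D)"

text \<open>
  A functor from the one-object category \<open>\<int>\<close> to \<open>C\<close> is given by the image \<open>fst F\<close> of the
  object and the family \<open>snd F n\<close> of images of the morphisms \<open>n\<close>, where composition in the
  group \<open>\<int>\<close> is addition. A natural transformation has a single component, which represents it.
\<close>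

type_synonym ('o, 'm) Z_functor = "'o \<times> (int \<Rightarrow> 'm)"

definition is_Z_functor :: "('o, 'm) bmcat \<Rightarrow> ('o, 'm) Z_functor \<Rightarrow> bool" where
  "is_Z_functor C F \<longleftrightarrow> fst F \<in> Ob C \<and> (\<forall>n. snd F n \<in> Hom C (fst F) (fst F)) \<and>
     snd F 0 = \<one>\<^bsub>C\<^esub> (fst F) \<and> (\<forall>m n. snd F (m + n) = snd F m \<cdot>\<^bsub>C\<^esub> snd F n)"

definition f_cat :: "('o, 'm) bmcat \<Rightarrow> (('o, 'm) Z_functor, 'm) bmcat" where
  "f_cat C = \<lparr>
     Ob = {F. is_Z_functor C F},
     Hom = (\<lambda>F G. {f \<in> Hom C (fst F) (fst G). is_Z_functor C F \<and> is_Z_functor C G \<and>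
                     (\<forall>n. snd G n \<cdot>\<^bsub>C\<^esub> f = f \<cdot>\<^bsub>C\<^esub> snd F n)}),
     ident = (\<lambda>F. \<one>\<^bsub>C\<^esub> (fst F)),
     comp = comp C,
     unit_ob = (\<I>\<^bsub>C\<^esub>, \<lambda>n. \<one>\<^bsub>C\<^esub> \<I>\<^bsub>C\<^esub>),
     tensor_ob = (\<lambda>F G. (fst F \<odot>\<^bsub>C\<^esub> fst G, \<lambda>n. snd F n \<otimes>\<^bsub>C\<^esub> snd G n)),
     tensor = tensor C,
     braiding = (\<lambda>F G. \<tau>\<^bsub>C\<^esub> (fst F) (fst G)) \<rparr>"

definition f_aut :: "('o, 'm) Z_functor \<Rightarrow> 'm" where
  "f_aut F = snd F 1"

context strict_braided_monoidal_category
begin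

lemma is_Z_functor_unit: "is_Z_functor C (\<I>, \<lambda>n. \<one> \<I>)"
  unfolding is_Z_functor_def using unit_ob ident_hom ident_left by fastforce

lemma is_Z_functor_tensor:
  assumes "is_Z_functor C F" "is_Z_functor C G"
  shows "is_Z_functor C (fst F \<odot> fst G, \<lambda>n. snd F n \<otimes> snd G n)"
proof -
  have F: "snd F n \<in> Hom C (fst F) (fst F)" and G: "snd G n \<in> Hom C (fst G) (fst G)" for n
    using assms by (simp_all add: is_Z_functor_def)
  show ?thesis
    using assms unfolding is_Z_functor_def
    by (simp add: tensor_ob tensor_hom tensor_ident interchange[OF F F G G])
qed

lemma f_braiding_iso:
  assumes F: "is_Z_functor C F" and G: "is_Z_functor C G"
  shows "iso_arrow (f_cat C) (fst F \<odot> fst G, \<lambda>n. snd F n \<otimes> snd G n)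
           (fst G \<odot> fst F, \<lambda>n. snd G n \<otimes> snd F n) (\<tau> (fst F) (fst G))"
proof -
  let ?A = "fst F" and ?B = "fst G"
  have A: "?A \<in> Ob C" "?B \<in> Ob C" and FH: "\<And>n. snd F n \<in> Hom C ?A ?A" "\<And>n. snd G n \<in> Hom C ?B ?B"
    using F G by (auto simp: is_Z_functor_def)
  obtain g where t: "\<tau> ?A ?B \<in> Hom C (?A \<odot> ?B) (?B \<odot> ?A)"
    and g: "g \<in> Hom C (?B \<odot> ?A) (?A \<odot> ?B)"
      "g \<cdot> \<tau> ?A ?B = \<one> (?A \<odot> ?B)" "\<tau> ?A ?B \<cdot> g = \<one> (?B \<odot> ?A)"
    using braiding_iso[OF A] by (auto simp: iso_arrow_def)
  have nat: "\<tau> ?A ?B \<cdot> (snd F n \<otimes> snd G n) = (snd G n \<otimes> snd F n) \<cdot> \<tau> ?A ?B" for n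
    using braiding_natural FH by blast
  have "(snd F n \<otimes> snd G n) \<cdot> g = g \<cdot> (snd G n \<otimes> snd F n)" for n
  proof -
    let ?f = "snd F n \<otimes> snd G n" and ?h = "snd G n \<otimes> snd F n"
    have f: "?f \<in> Hom C (?A \<odot> ?B) (?A \<odot> ?B)" and h: "?h \<in> Hom C (?B \<odot> ?A) (?B \<odot> ?A)"
      using tensor_hom FH by auto
    have "?f \<cdot> g = (g \<cdot> \<tau> ?A ?B) \<cdot> (?f \<cdot> g)"
      using ident_left[OF comp_hom[OF f g(1)]] g by simp
    also have "\<dots> = g \<cdot> (\<tau> ?A ?B \<cdot> (?f \<cdot> g))"
      using comp_assoc[OF g(1) t comp_hom[OF f g(1)]] .
    also have "\<tau> ?A ?B \<cdot> (?f \<cdot> g) = (?h \<cdot> \<tau> ?A ?B) \<cdot> g"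
      using comp_assoc[OF t f g(1)] nat by simp
    also have "\<dots> = ?h"
      using comp_assoc[OF h t g(1)] g ident_right[OF h] by simp
    finally show ?thesis .
  qed
  then show ?thesis
    using t g nat is_Z_functor_tensor[OF F G] is_Z_functor_tensor[OF G F]
    by (auto simp: iso_arrow_def f_cat_def)
qed

theorem f_cat_strict_braided_monoidal: "strict_braided_monoidal_category (f_cat C)"
proof -
  have ob: "is_Z_functor C F \<Longrightarrow> fst F \<in> Ob C" for F
    by (simp add: is_Z_functor_def)
  have hom: "is_Z_functor C F \<Longrightarrow> snd F n \<in> Hom C (fst F) (fst F)" for F n
    by (simp add: is_Z_functor_def)
  have comp_nat: "k \<cdot> (g \<cdot> f) = (g \<cdot> f) \<cdot> p"
    if "g \<in> Hom C B D" "f \<in> Hom C A B" "k \<in> Hom C D D" "q \<in> Hom C B B" "p \<in> Hom C A A"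
      "k \<cdot> g = g \<cdot> q" "q \<cdot> f = f \<cdot> p" for A B D f g k p q
    using comp_assoc[OF that(3,1,2)] comp_assoc[OF that(1,4,2)] comp_assoc[OF that(1,2,5)]
      that(6,7) by simp
  have tensor_nat: "(k \<otimes> k') \<cdot> (f \<otimes> g) = (f \<otimes> g) \<cdot> (p \<otimes> p')"
    if "f \<in> Hom C A B" "g \<in> Hom C A' B'" "k \<in> Hom C B B" "k' \<in> Hom C B' B'"
      "p \<in> Hom C A A" "p' \<in> Hom C A' A'" "k \<cdot> f = f \<cdot> p" "k' \<cdot> g = g \<cdot> p'" for A B A' B' f g k k' p p'
    using interchange[OF that(1,3,2,4)] interchange[OF that(5,1,6,2)] that(7,8) by simp
  show ?thesis
  proof (unfold_locales, goal_cases)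
    case (3 g B D f A)
    then have *: "g \<in> Hom C (fst B) (fst D)" "f \<in> Hom C (fst A) (fst B)"
        "is_Z_functor C A" "is_Z_functor C B" "is_Z_functor C D"
        "snd D n \<cdot> g = g \<cdot> snd B n" "snd B n \<cdot> f = f \<cdot> snd A n" for n
      by (simp_all add: f_cat_def)
    show ?case
      using * comp_hom[OF *(1,2)] comp_nat[OF *(1,2) hom[OF *(5)] hom[OF *(4)] hom[OF *(3)] *(6,7)]
      by (simp add: f_cat_def)
  next
    case (9 f A B g D E)
    then have *: "f \<in> Hom C (fst A) (fst B)" "g \<in> Hom C (fst D) (fst E)"
        "is_Z_functor C A" "is_Z_functor C B" "is_Z_functor C D" "is_Z_functor C E"
        "snd B n \<cdot> f = f \<cdot> snd A n" "snd E n \<cdot> g = g \<cdot> snd D n" for n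
      by (simp_all add: f_cat_def)
    show ?case
      using tensor_hom[OF *(1,2)] is_Z_functor_tensor[OF *(3,5)] is_Z_functor_tensor[OF *(4,6)]
        tensor_nat[OF *(1,2) hom[OF *(4)] hom[OF *(6)] hom[OF *(3)] hom[OF *(5)] *(7,8)]
      by (simp add: f_cat_def)
  next
    case (16 A B)
    then show ?case
      using f_braiding_iso by (auto simp: f_cat_def)
  next
    case (13 A)
    then have "is_Z_functor C A" by (simp add: f_cat_def)
    then have "\<I> \<odot> fst A = fst A \<and> fst A \<odot> \<I> = fst A"
      "\<one> \<I> \<otimes> snd A n = snd A n \<and> snd A n \<otimes> \<one> \<I> = snd A n" for n
      using tensor_ob_unit[OF ob] tensor_unit[OF hom] by blast+
    then show ?case by (simp add: f_cat_def)
  next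
    case (12 A B D)
    then show ?case
      using tensor_ob_assoc[OF ob ob ob] tensor_assoc[OF hom hom hom] by (simp add: f_cat_def)
  next
    case (2 A)
    then have A: "is_Z_functor C A" by (simp add: f_cat_def)
    then show ?case
      using ident_hom[OF ob[OF A]] ident_left[OF hom[OF A]] ident_right[OF hom[OF A]]
      by (simp add: f_cat_def)
  next
    case (4 h D E g B f A)
    then show ?case using comp_assoc[of h "fst D" "fst E" g "fst B" f "fst A"]
      by (simp add: f_cat_def)
  next
    case (11 f A B f' D g A' B' g' D')
    then show ?case
      using interchange[of f "fst A" "fst B" f' "fst D" g "fst A'" "fst B'" g' "fst D'"]
      by (simp add: f_cat_def)
  next
    case (14 f A A' g B B' h D D')
    then show ?case
      using tensor_assoc[of f "fst A" "fst A'" g "fst B" "fst B'" h "fst D" "fst D'"]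
      by (simp add: f_cat_def)
  next
    case (17 f A A' g B B')
    then show ?case
      using braiding_natural[of f "fst A" "fst A'" g "fst B" "fst B'"] by (simp add: f_cat_def)
  next
    case (5 f A B)
    then show ?case using ident_left[of f "fst A" "fst B"] by (simp add: f_cat_def)
  next
    case (6 f A B)
    then show ?case using ident_right[of f "fst A" "fst B"] by (simp add: f_cat_def)
  next
    case (15 f A B)
    then show ?case using tensor_unit[of f "fst A" "fst B"] by (simp add: f_cat_def)
  qed (simp_all add: f_cat_def ob unit_ob tensor_ident is_Z_functor_unit
         is_Z_functor_tensor hexagon_left hexagon_right)
qed

end

definition algebra_object :: "('o, 'm) bmcat \<Rightarrow> 'o \<Rightarrow> 'm \<Rightarrow> 'm \<Rightarrow> bool" where
  "algebra_object D H \<mu> \<eta> \<longleftrightarrow> H \<in> Ob D \<and>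
     \<mu> \<in> Hom D (H \<odot>\<^bsub>D\<^esub> H) H \<and> \<eta> \<in> Hom D \<I>\<^bsub>D\<^esub> H \<and>
     \<mu> \<cdot>\<^bsub>D\<^esub> (\<mu> \<otimes>\<^bsub>D\<^esub> \<one>\<^bsub>D\<^esub> H) = \<mu> \<cdot>\<^bsub>D\<^esub> (\<one>\<^bsub>D\<^esub> H \<otimes>\<^bsub>D\<^esub> \<mu>) \<and>
     \<mu> \<cdot>\<^bsub>D\<^esub> (\<eta> \<otimes>\<^bsub>D\<^esub> \<one>\<^bsub>D\<^esub> H) = \<one>\<^bsub>D\<^esub> H \<and>
     \<mu> \<cdot>\<^bsub>D\<^esub> (\<one>\<^bsub>D\<^esub> H \<otimes>\<^bsub>D\<^esub> \<eta>) = \<one>\<^bsub>D\<^esub> H"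

definition coalgebra_object :: "('o, 'm) bmcat \<Rightarrow> 'o \<Rightarrow> 'm \<Rightarrow> 'm \<Rightarrow> bool" where
  "coalgebra_object D H \<Delta> \<epsilon> \<longleftrightarrow> H \<in> Ob D \<and>
     \<Delta> \<in> Hom D H (H \<odot>\<^bsub>D\<^esub> H) \<and> \<epsilon> \<in> Hom D H \<I>\<^bsub>D\<^esub> \<and>
     (\<Delta> \<otimes>\<^bsub>D\<^esub> \<one>\<^bsub>D\<^esub> H) \<cdot>\<^bsub>D\<^esub> \<Delta> = (\<one>\<^bsub>D\<^esub> H \<otimes>\<^bsub>D\<^esub> \<Delta>) \<cdot>\<^bsub>D\<^esub> \<Delta> \<and>
     (\<epsilon> \<otimes>\<^bsub>D\<^esub> \<one>\<^bsub>D\<^esub> H) \<cdot>\<^bsub>D\<^esub> \<Delta> = \<one>\<^bsub>D\<^esub> H \<and>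
     (\<one>\<^bsub>D\<^esub> H \<otimes>\<^bsub>D\<^esub> \<epsilon>) \<cdot>\<^bsub>D\<^esub> \<Delta> = \<one>\<^bsub>D\<^esub> H"

text \<open>
  The product is called \<open>\<mu>\<close>, since nabla is not a letter in Isabelle. The last three
  equations say that \<open>\<eta>\<close> is a morphism of coalgebras and \<open>\<epsilon>\<close> is a morphism of algebras.
\<close>

definition hopf_object ::
  "('o, 'm) bmcat \<Rightarrow> 'o \<Rightarrow> 'm \<Rightarrow> 'm \<Rightarrow> 'm \<Rightarrow> 'm \<Rightarrow> 'm \<Rightarrow> bool" where
  "hopf_object D H \<mu> \<eta> \<Delta> \<epsilon> S \<longleftrightarrow>
     algebra_object D H \<mu> \<eta> \<and> coalgebra_object D H \<Delta> \<epsilon> \<and> iso_arrow D H H S \<and>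
     (\<mu> \<otimes>\<^bsub>D\<^esub> \<mu>) \<cdot>\<^bsub>D\<^esub> (\<one>\<^bsub>D\<^esub> H \<otimes>\<^bsub>D\<^esub> \<tau>\<^bsub>D\<^esub> H H \<otimes>\<^bsub>D\<^esub> \<one>\<^bsub>D\<^esub> H) \<cdot>\<^bsub>D\<^esub> (\<Delta> \<otimes>\<^bsub>D\<^esub> \<Delta>) = \<Delta> \<cdot>\<^bsub>D\<^esub> \<mu> \<and>
     \<mu> \<cdot>\<^bsub>D\<^esub> (S \<otimes>\<^bsub>D\<^esub> \<one>\<^bsub>D\<^esub> H) \<cdot>\<^bsub>D\<^esub> \<Delta> = \<eta> \<cdot>\<^bsub>D\<^esub> \<epsilon> \<and>
     \<mu> \<cdot>\<^bsub>D\<^esub> (\<one>\<^bsub>D\<^esub> H \<otimes>\<^bsub>D\<^esub> S) \<cdot>\<^bsub>D\<^esub> \<Delta> = \<eta> \<cdot>\<^bsub>D\<^esub> \<epsilon> \<and>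
     \<Delta> \<cdot>\<^bsub>D\<^esub> \<eta> = \<eta> \<otimes>\<^bsub>D\<^esub> \<eta> \<and> \<epsilon> \<cdot>\<^bsub>D\<^esub> \<mu> = \<epsilon> \<otimes>\<^bsub>D\<^esub> \<epsilon> \<and> \<epsilon> \<cdot>\<^bsub>D\<^esub> \<eta> = \<one>\<^bsub>D\<^esub> \<I>\<^bsub>D\<^esub>"

definition hopf_f_object ::
  "('o, 'm) bmcat \<Rightarrow> ('o, 'm) Z_functor \<Rightarrow> 'm \<Rightarrow> 'm \<Rightarrow> 'm \<Rightarrow> 'm \<Rightarrow> 'm \<Rightarrow> bool" where
  "hopf_f_object C = hopf_object (f_cat C)"

definition left_module :: "('o, 'm) bmcat \<Rightarrow> 'o \<Rightarrow> 'm \<Rightarrow> 'm \<Rightarrow> 'o \<Rightarrow> 'm \<Rightarrow> bool" where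
  "left_module D H \<mu> \<eta> Y l \<longleftrightarrow> Y \<in> Ob D \<and> l \<in> Hom D (H \<odot>\<^bsub>D\<^esub> Y) Y \<and>
     l \<cdot>\<^bsub>D\<^esub> (\<mu> \<otimes>\<^bsub>D\<^esub> \<one>\<^bsub>D\<^esub> Y) = l \<cdot>\<^bsub>D\<^esub> (\<one>\<^bsub>D\<^esub> H \<otimes>\<^bsub>D\<^esub> l) \<and>
     l \<cdot>\<^bsub>D\<^esub> (\<eta> \<otimes>\<^bsub>D\<^esub> \<one>\<^bsub>D\<^esub> Y) = \<one>\<^bsub>D\<^esub> Y"

definition left_comodule :: "('o, 'm) bmcat \<Rightarrow> 'o \<Rightarrow> 'm \<Rightarrow> 'm \<Rightarrow> 'o \<Rightarrow> 'm \<Rightarrow> bool" where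
  "left_comodule D H \<Delta> \<epsilon> Y d \<longleftrightarrow> Y \<in> Ob D \<and> d \<in> Hom D Y (H \<odot>\<^bsub>D\<^esub> Y) \<and>
     (\<Delta> \<otimes>\<^bsub>D\<^esub> \<one>\<^bsub>D\<^esub> Y) \<cdot>\<^bsub>D\<^esub> d = (\<one>\<^bsub>D\<^esub> H \<otimes>\<^bsub>D\<^esub> d) \<cdot>\<^bsub>D\<^esub> d \<and>
     (\<epsilon> \<otimes>\<^bsub>D\<^esub> \<one>\<^bsub>D\<^esub> Y) \<cdot>\<^bsub>D\<^esub> d = \<one>\<^bsub>D\<^esub> Y"

definition right_module :: "('o, 'm) bmcat \<Rightarrow> 'o \<Rightarrow> 'm \<Rightarrow> 'm \<Rightarrow> 'o \<Rightarrow> 'm \<Rightarrow> bool" where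
  "right_module D H \<mu> \<eta> Y r \<longleftrightarrow> Y \<in> Ob D \<and> r \<in> Hom D (Y \<odot>\<^bsub>D\<^esub> H) Y \<and>
     r \<cdot>\<^bsub>D\<^esub> (\<one>\<^bsub>D\<^esub> Y \<otimes>\<^bsub>D\<^esub> \<mu>) = r \<cdot>\<^bsub>D\<^esub> (r \<otimes>\<^bsub>D\<^esub> \<one>\<^bsub>D\<^esub> H) \<and>
     r \<cdot>\<^bsub>D\<^esub> (\<one>\<^bsub>D\<^esub> Y \<otimes>\<^bsub>D\<^esub> \<eta>) = \<one>\<^bsub>D\<^esub> Y"

definition right_comodule :: "('o, 'm) bmcat \<Rightarrow> 'o \<Rightarrow> 'm \<Rightarrow> 'm \<Rightarrow> 'o \<Rightarrow> 'm \<Rightarrow> bool" where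
  "right_comodule D H \<Delta> \<epsilon> Y d \<longleftrightarrow> Y \<in> Ob D \<and> d \<in> Hom D Y (Y \<odot>\<^bsub>D\<^esub> H) \<and>
     (\<one>\<^bsub>D\<^esub> Y \<otimes>\<^bsub>D\<^esub> \<Delta>) \<cdot>\<^bsub>D\<^esub> d = (d \<otimes>\<^bsub>D\<^esub> \<one>\<^bsub>D\<^esub> H) \<cdot>\<^bsub>D\<^esub> d \<and>
     (\<one>\<^bsub>D\<^esub> Y \<otimes>\<^bsub>D\<^esub> \<epsilon>) \<cdot>\<^bsub>D\<^esub> d = \<one>\<^bsub>D\<^esub> Y"

definition left_yd_condition ::
  "('o, 'm) bmcat \<Rightarrow> 'o \<Rightarrow> 'm \<Rightarrow> 'm \<Rightarrow> 'm \<Rightarrow> 'o \<Rightarrow> 'm \<Rightarrow> 'm \<Rightarrow> bool" where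
  "left_yd_condition D H \<phi> \<mu> \<Delta> Y l d \<longleftrightarrow>
     (\<mu> \<otimes>\<^bsub>D\<^esub> \<one>\<^bsub>D\<^esub> Y) \<cdot>\<^bsub>D\<^esub> (\<one>\<^bsub>D\<^esub> H \<otimes>\<^bsub>D\<^esub> \<tau>\<^bsub>D\<^esub> Y H) \<cdot>\<^bsub>D\<^esub> (d \<cdot>\<^bsub>D\<^esub> l \<otimes>\<^bsub>D\<^esub> \<phi>)
       \<cdot>\<^bsub>D\<^esub> (\<one>\<^bsub>D\<^esub> H \<otimes>\<^bsub>D\<^esub> \<tau>\<^bsub>D\<^esub> H Y) \<cdot>\<^bsub>D\<^esub> (\<Delta> \<otimes>\<^bsub>D\<^esub> \<one>\<^bsub>D\<^esub> Y)
     = (\<mu> \<otimes>\<^bsub>D\<^esub> l) \<cdot>\<^bsub>D\<^esub> (\<one>\<^bsub>D\<^esub> H \<otimes>\<^bsub>D\<^esub> \<tau>\<^bsub>D\<^esub> H H \<otimes>\<^bsub>D\<^esub> \<one>\<^bsub>D\<^esub> Y) \<cdot>\<^bsub>D\<^esub> (\<Delta> \<otimes>\<^bsub>D\<^esub> d)"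

definition right_yd_condition ::
  "('o, 'm) bmcat \<Rightarrow> 'o \<Rightarrow> 'm \<Rightarrow> 'm \<Rightarrow> 'm \<Rightarrow> 'o \<Rightarrow> 'm \<Rightarrow> 'm \<Rightarrow> bool" where
  "right_yd_condition D H \<phi> \<mu> \<Delta> Y r d \<longleftrightarrow>
     (\<one>\<^bsub>D\<^esub> Y \<otimes>\<^bsub>D\<^esub> \<mu>) \<cdot>\<^bsub>D\<^esub> (\<tau>\<^bsub>D\<^esub> H Y \<otimes>\<^bsub>D\<^esub> \<one>\<^bsub>D\<^esub> H) \<cdot>\<^bsub>D\<^esub> (\<phi> \<otimes>\<^bsub>D\<^esub> d \<cdot>\<^bsub>D\<^esub> r)
       \<cdot>\<^bsub>D\<^esub> (\<tau>\<^bsub>D\<^esub> Y H \<otimes>\<^bsub>D\<^esub> \<one>\<^bsub>D\<^esub> H) \<cdot>\<^bsub>D\<^esub> (\<one>\<^bsub>D\<^esub> Y \<otimes>\<^bsub>D\<^esub> \<Delta>)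
     = (r \<otimes>\<^bsub>D\<^esub> \<mu>) \<cdot>\<^bsub>D\<^esub> (\<one>\<^bsub>D\<^esub> Y \<otimes>\<^bsub>D\<^esub> \<tau>\<^bsub>D\<^esub> H H \<otimes>\<^bsub>D\<^esub> \<one>\<^bsub>D\<^esub> H) \<cdot>\<^bsub>D\<^esub> (d \<otimes>\<^bsub>D\<^esub> \<Delta>)"

definition left_yd_f_object ::
  "('o, 'm) bmcat \<Rightarrow> ('o, 'm) Z_functor \<Rightarrow> 'm \<Rightarrow> 'm \<Rightarrow> 'm \<Rightarrow> 'm \<Rightarrow>
   ('o, 'm) Z_functor \<Rightarrow> 'm \<Rightarrow> 'm \<Rightarrow> bool" where
  "left_yd_f_object C H \<mu> \<eta> \<Delta> \<epsilon> Y l d \<longleftrightarrow>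
     left_module (f_cat C) H \<mu> \<eta> Y l \<and> left_comodule (f_cat C) H \<Delta> \<epsilon> Y d \<and>
     left_yd_condition (f_cat C) H (f_aut H) \<mu> \<Delta> Y l d"

definition right_yd_f_object ::
  "('o, 'm) bmcat \<Rightarrow> ('o, 'm) Z_functor \<Rightarrow> 'm \<Rightarrow> 'm \<Rightarrow> 'm \<Rightarrow> 'm \<Rightarrow>
   ('o, 'm) Z_functor \<Rightarrow> 'm \<Rightarrow> 'm \<Rightarrow> bool" where
  "right_yd_f_object C H \<mu> \<eta> \<Delta> \<epsilon> Y r d \<longleftrightarrow>
     right_module (f_cat C) H \<mu> \<eta> Y r \<and> right_comodule (f_cat C) H \<Delta> \<epsilon> Y d \<and>
     right_yd_condition (f_cat C) H (f_aut H) \<mu> \<Delta> Y r d"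

end

theory Submission
  imports Defs
begin

text \<open>
In Sweedler notation, and leaving the braidings implicit, the coaction of the first part is
\<open>\<delta>(x) = x\<^sub>1 S\<phi>(x\<^sub>3) \<otimes> x\<^sub>2\<close>. Let \<open>H\<close> act on \<open>H \<otimes> V\<close> from the right by \<open>(a \<otimes> v) h = a h \<otimes> v\<close>,
where \<open>h\<close> moves past \<open>v\<close> along the braiding (\<open>shift_act\<close>). For such an action, and for a right
\<open>H\<close>-coaction on \<open>X\<close>, morphisms \<open>X \<rightarrow> H \<otimes> V\<close> form a right module over the convolution algebra of
endomorphisms of \<open>H\<close>; write \<open>f * a\<close> for \<open>x \<mapsto> f(x\<^sub>0) a(x\<^sub>1)\<close>. In these terms \<open>\<delta> = \<Delta> * S\<phi>\<close>. As
\<open>\<phi>\<close> and \<open>S\<phi>\<close> are convolution inverse to each other, \<open>\<delta> * \<phi> = \<Delta>\<close>, that is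
\<open>\<delta>(x\<^sub>1) \<phi>(x\<^sub>2) = \<Delta>(x)\<close>, and \<open>f = g\<close> follows from \<open>f * \<phi> = g * \<phi>\<close> (\<open>convolution_cancel\<close>).

The two substantial properties of \<open>\<delta>\<close> are proved by such a cancellation, which removes the
antipode from the calculation. The Yetter--Drinfel'd condition is \<open>\<delta>(h\<^sub>1 y) \<phi>(h\<^sub>2) = \<Delta>(h) \<delta>(y)\<close>. Convolving with \<open>\<phi>\<close> in the
variable \<open>y\<close> turns the left side into \<open>\<delta>(h\<^sub>1 y\<^sub>1) \<phi>(h\<^sub>2 y\<^sub>2) = \<Delta>(h y)\<close> and the right side into
\<open>\<Delta>(h) \<Delta>(y)\<close>. Coassociativity of \<open>\<delta>\<close> follows in the same way after two cancellations, one for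
each of the first two tensor factors: both sides become \<open>x \<mapsto> x\<^sub>1 \<otimes> x\<^sub>2 \<otimes> x\<^sub>3\<close>.

The second part is the first part in the category \<open>dual_cat\<close> obtained by reversing both the
arrows and the tensor product. This keeps the braiding, exchanges product and coproduct as well
as left and right, and takes \<open>\<delta>\<close> to the action \<open>y \<otimes> h \<mapsto> S\<phi>(h\<^sub>1) y h\<^sub>2\<close>.

Functors \<open>\<int> \<rightarrow> C\<close> enter only through the fact that \<open>\<phi> = H(1)\<close> commutes with all structure
morphisms of \<open>H\<close>, because these are natural transformations. Everything else holds for a Hopf
object in any strict braided monoidal category with an endomorphism of that kind.
\<close>

section \<open>Typed arrows\<close>

text \<open>
Hom-sets may overlap, so a morphism does not determine its source and target. Arrows that carry
both make all side conditions of the category laws computable by rewriting.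
\<close>

datatype ('o, 'm) arrow = Arrow (src: 'o) (mor: 'm) (trg: 'o)

context strict_braided_monoidal_category
begin

definition arr :: "('o, 'm) arrow \<Rightarrow> bool" where
  "arr f \<longleftrightarrow> mor f \<in> Hom C (src f) (trg f)"

definition cmp :: "('o, 'm) arrow \<Rightarrow> ('o, 'm) arrow \<Rightarrow> ('o, 'm) arrow"  (infixr "\<bullet>" 75) where
  "g \<bullet> f = Arrow (src f) (mor g \<cdot> mor f) (trg g)"

definition ten :: "('o, 'm) arrow \<Rightarrow> ('o, 'm) arrow \<Rightarrow> ('o, 'm) arrow"  (infixr "\<boxtimes>" 70) where
  "f \<boxtimes> g = Arrow (src f \<odot> src g) (mor f \<otimes> mor g) (trg f \<odot> trg g)"

definition idn :: "'o \<Rightarrow> ('o, 'm) arrow"  ("\<iota>") where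
  "\<iota> A = Arrow A (\<one> A) A"

definition brd :: "'o \<Rightarrow> 'o \<Rightarrow> ('o, 'm) arrow"  ("\<beta>") where
  "\<beta> A B = Arrow (A \<odot> B) (\<tau> A B) (B \<odot> A)"

abbreviation typed_arrow :: "('o, 'm) arrow \<Rightarrow> 'o \<Rightarrow> 'o \<Rightarrow> bool"  ("\<guillemotleft>_ : _ \<rightarrow> _\<guillemotright>") where
  "\<guillemotleft>f : A \<rightarrow> B\<guillemotright> \<equiv> arr f \<and> src f = A \<and> trg f = B"

lemma src_trg_simps [simp]:
  "src (g \<bullet> f) = src f" "trg (g \<bullet> f) = trg g"
  "src (f \<boxtimes> g) = src f \<odot> src g" "trg (f \<boxtimes> g) = trg f \<odot> trg g"
  "src (\<iota> A) = A" "trg (\<iota> A) = A"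
  "src (\<beta> A B) = A \<odot> B" "trg (\<beta> A B) = B \<odot> A"
  by (simp_all add: cmp_def ten_def idn_def brd_def)

lemma mor_simps:
  "mor (g \<bullet> f) = mor g \<cdot> mor f" "mor (f \<boxtimes> g) = mor f \<otimes> mor g"
  "mor (\<iota> A) = \<one> A" "mor (\<beta> A B) = \<tau> A B"
  by (simp_all add: cmp_def ten_def idn_def brd_def)

lemma ob_simps [simp]:
  "arr f \<Longrightarrow> src f \<in> Ob C" "arr f \<Longrightarrow> trg f \<in> Ob C"
  "A \<in> Ob C \<Longrightarrow> B \<in> Ob C \<Longrightarrow> A \<odot> B \<in> Ob C" "\<I> \<in> Ob C"
  "A \<in> Ob C \<Longrightarrow> \<I> \<odot> A = A" "A \<in> Ob C \<Longrightarrow> A \<odot> \<I> = A"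
  "A \<in> Ob C \<Longrightarrow> B \<in> Ob C \<Longrightarrow> D \<in> Ob C \<Longrightarrow> (A \<odot> B) \<odot> D = A \<odot> B \<odot> D"
  using hom_ob tensor_ob unit_ob tensor_ob_unit tensor_ob_assoc by (auto simp: arr_def)

lemma arr_simps [simp]:
  "arr g \<Longrightarrow> arr f \<Longrightarrow> trg f = src g \<Longrightarrow> arr (g \<bullet> f)"
  "arr f \<Longrightarrow> arr g \<Longrightarrow> arr (f \<boxtimes> g)"
  "A \<in> Ob C \<Longrightarrow> arr (\<iota> A)"
  "A \<in> Ob C \<Longrightarrow> B \<in> Ob C \<Longrightarrow> arr (\<beta> A B)"
  using comp_hom tensor_hom ident_hom braiding_iso
  by (auto simp: arr_def mor_simps iso_arrow_def)

lemma cmp_ident [simp]: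
  "arr f \<Longrightarrow> trg f = A \<Longrightarrow> \<iota> A \<bullet> f = f" "arr f \<Longrightarrow> src f = A \<Longrightarrow> f \<bullet> \<iota> A = f"
  using ident_left ident_right by (auto simp: arr_def cmp_def idn_def)

lemma cmp_assoc [simp]:
  "arr h \<Longrightarrow> arr g \<Longrightarrow> arr f \<Longrightarrow> trg g = src h \<Longrightarrow> trg f = src g \<Longrightarrow>
    (h \<bullet> g) \<bullet> f = h \<bullet> g \<bullet> f"
  using comp_assoc by (auto simp: arr_def cmp_def)

lemma ten_assoc [simp]:
  "arr f \<Longrightarrow> arr g \<Longrightarrow> arr h \<Longrightarrow> (f \<boxtimes> g) \<boxtimes> h = f \<boxtimes> g \<boxtimes> h"
proof -
  assume a: "arr f" "arr g" "arr h"
  then have "(mor f \<otimes> mor g) \<otimes> mor h = mor f \<otimes> (mor g \<otimes> mor h)"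
    using tensor_assoc by (auto simp: arr_def)
  then show ?thesis using a by (simp add: ten_def)
qed

lemma ten_ident [simp]:
  "A \<in> Ob C \<Longrightarrow> B \<in> Ob C \<Longrightarrow> \<iota> (A \<odot> B) = \<iota> A \<boxtimes> \<iota> B"
  by (simp add: ten_def idn_def tensor_ident)

lemma cmp_ten_ident [simp]:
  assumes "A \<in> Ob C" "B \<in> Ob C"
  shows "arr f \<Longrightarrow> trg f = A \<odot> B \<Longrightarrow> (\<iota> A \<boxtimes> \<iota> B) \<bullet> f = f"
    "arr f \<Longrightarrow> src f = A \<odot> B \<Longrightarrow> f \<bullet> (\<iota> A \<boxtimes> \<iota> B) = f"
  using assms by (simp_all flip: ten_ident)

lemma ten_unit [simp]: "arr f \<Longrightarrow> \<iota> \<I> \<boxtimes> f = f" "arr f \<Longrightarrow> f \<boxtimes> \<iota> \<I> = f"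
proof -
  assume a: "arr f"
  then have "\<one> \<I> \<otimes> mor f = mor f" "mor f \<otimes> \<one> \<I> = mor f"
    using tensor_unit by (auto simp: arr_def)
  then show "\<iota> \<I> \<boxtimes> f = f" "f \<boxtimes> \<iota> \<I> = f" using a by (simp_all add: ten_def idn_def arrow.expand)
qed

lemma ten_cmp:
  "arr f' \<Longrightarrow> arr g' \<Longrightarrow> arr f \<Longrightarrow> arr g \<Longrightarrow> trg f = src f' \<Longrightarrow> trg g = src g' \<Longrightarrow>
    (f' \<boxtimes> g') \<bullet> (f \<boxtimes> g) = f' \<bullet> f \<boxtimes> g' \<bullet> g"
  using interchange by (auto simp: arr_def ten_def cmp_def)

text \<open>
In the right-nested normal form of tensor products, two layers of a diagram can often be cut at a
common position without having the same number of factors on the left of the cut. The next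
variants of the interchange law cover the cuts after one or two factors, some of them also in front
of a further composite.
\<close>

lemma ten_cmp_chain:
  "arr f' \<Longrightarrow> arr g' \<Longrightarrow> arr f \<Longrightarrow> arr g \<Longrightarrow> arr x \<Longrightarrow> trg f = src f' \<Longrightarrow> trg g = src g' \<Longrightarrow>
    trg x = src f \<odot> src g \<Longrightarrow>
    (f' \<boxtimes> g') \<bullet> (f \<boxtimes> g) \<bullet> x = (f' \<bullet> f \<boxtimes> g' \<bullet> g) \<bullet> x"
  by (simp add: ten_cmp flip: cmp_assoc)

lemma ten_cmp_21:
  "arr f' \<Longrightarrow> arr g' \<Longrightarrow> arr f1 \<Longrightarrow> arr f2 \<Longrightarrow> arr g \<Longrightarrow> src f' = trg f1 \<odot> trg f2 \<Longrightarrow> trg g = src g' \<Longrightarrow>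
    (f' \<boxtimes> g') \<bullet> (f1 \<boxtimes> f2 \<boxtimes> g) = f' \<bullet> (f1 \<boxtimes> f2) \<boxtimes> g' \<bullet> g"
  by (simp add: ten_cmp flip: ten_assoc)

lemma ten_cmp_12:
  "arr f1 \<Longrightarrow> arr f2 \<Longrightarrow> arr g' \<Longrightarrow> arr f \<Longrightarrow> arr g \<Longrightarrow> trg f = src f1 \<odot> src f2 \<Longrightarrow> trg g = src g' \<Longrightarrow>
    (f1 \<boxtimes> f2 \<boxtimes> g') \<bullet> (f \<boxtimes> g) = (f1 \<boxtimes> f2) \<bullet> f \<boxtimes> g' \<bullet> g"
  by (simp add: ten_cmp flip: ten_assoc)

lemma ten_cmp_12_chain:
  "arr f1 \<Longrightarrow> arr f2 \<Longrightarrow> arr g' \<Longrightarrow> arr f \<Longrightarrow> arr g \<Longrightarrow> arr x \<Longrightarrow> trg f = src f1 \<odot> src f2 \<Longrightarrow>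
    trg g = src g' \<Longrightarrow> trg x = src f \<odot> src g \<Longrightarrow>
    (f1 \<boxtimes> f2 \<boxtimes> g') \<bullet> (f \<boxtimes> g) \<bullet> x = ((f1 \<boxtimes> f2) \<bullet> f \<boxtimes> g' \<bullet> g) \<bullet> x"
  by (simp add: ten_cmp_12 flip: cmp_assoc)

lemma ten_cmp_22:
  "arr f1 \<Longrightarrow> arr f2 \<Longrightarrow> arr g' \<Longrightarrow> arr h1 \<Longrightarrow> arr h2 \<Longrightarrow> arr g \<Longrightarrow>
    trg h1 \<odot> trg h2 = src f1 \<odot> src f2 \<Longrightarrow> trg g = src g' \<Longrightarrow>
    (f1 \<boxtimes> f2 \<boxtimes> g') \<bullet> (h1 \<boxtimes> h2 \<boxtimes> g) = (f1 \<boxtimes> f2) \<bullet> (h1 \<boxtimes> h2) \<boxtimes> g' \<bullet> g"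
  by (simp add: ten_cmp flip: ten_assoc)

lemmas interchange_simps = ten_cmp ten_cmp_21 ten_cmp_12 ten_cmp_22
  ten_cmp_chain ten_cmp_12_chain

lemma slide:
  "arr f \<Longrightarrow> arr g \<Longrightarrow>
    (\<iota> (trg f) \<boxtimes> g) \<bullet> (f \<boxtimes> \<iota> (src g)) = (f \<boxtimes> \<iota> (trg g)) \<bullet> (\<iota> (src f) \<boxtimes> g)"
  by (simp add: ten_cmp)

lemma whisker:
  "arr g \<Longrightarrow> arr f \<Longrightarrow> trg f = src g \<Longrightarrow> A \<in> Ob C \<Longrightarrow> g \<bullet> f \<boxtimes> \<iota> A = (g \<boxtimes> \<iota> A) \<bullet> (f \<boxtimes> \<iota> A)"
  "arr g \<Longrightarrow> arr f \<Longrightarrow> trg f = src g \<Longrightarrow> A \<in> Ob C \<Longrightarrow> \<iota> A \<boxtimes> g \<bullet> f = (\<iota> A \<boxtimes> g) \<bullet> (\<iota> A \<boxtimes> f)"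
  by (simp_all add: ten_cmp)

lemma cmp_eq_chain:
  "g \<bullet> f = g' \<bullet> f' \<Longrightarrow> arr g \<Longrightarrow> arr f \<Longrightarrow> arr g' \<Longrightarrow> arr f' \<Longrightarrow> arr x \<Longrightarrow> trg f = src g \<Longrightarrow>
    trg f' = src g' \<Longrightarrow> trg x = src f \<Longrightarrow> g \<bullet> f \<bullet> x = g' \<bullet> f' \<bullet> x"
  by (metis cmp_assoc src_trg_simps(1))

lemma braid_natural:
  "arr f \<Longrightarrow> arr g \<Longrightarrow> \<beta> (trg f) (trg g) \<bullet> (f \<boxtimes> g) = (g \<boxtimes> f) \<bullet> \<beta> (src f) (src g)"
  using braiding_natural by (auto simp: arr_def ten_def cmp_def brd_def)

lemma hexagons:
  assumes "A \<in> Ob C" "B \<in> Ob C" "D \<in> Ob C"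
  shows "\<beta> (A \<odot> B) D = (\<beta> A D \<boxtimes> \<iota> B) \<bullet> (\<iota> A \<boxtimes> \<beta> B D)"
    and "\<beta> A (B \<odot> D) = (\<iota> B \<boxtimes> \<beta> A D) \<bullet> (\<beta> A B \<boxtimes> \<iota> D)"
  using assms hexagon_left hexagon_right tensor_ob_assoc
  by (simp_all add: brd_def ten_def cmp_def idn_def)

text \<open>
The hexagon for \<open>A, \<I>, \<I>\<close> says that \<open>\<tau> A \<I>\<close> is idempotent, and it is invertible.
\<close>

lemma braid_unit:
  assumes A: "A \<in> Ob C"
  shows "\<beta> A \<I> = \<iota> A"
proof -
  let ?t = "\<tau> A \<I>"
  obtain g where t: "?t \<in> Hom C A A" and g: "g \<in> Hom C A A" "g \<cdot> ?t = \<one> A"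
    using braiding_iso[OF A unit_ob] A by (auto simp: iso_arrow_def)
  have "?t = ?t \<cdot> ?t"
    using hexagon_right[OF A unit_ob unit_ob] A tensor_unit[OF t] by simp
  \<comment> \<open>Cancel one factor of the idempotent.\<close>
  then have "g \<cdot> ?t = (g \<cdot> ?t) \<cdot> ?t" using comp_assoc[OF g(1) t t] by simp
  then have "?t = \<one> A" using g ident_left[OF t] by simp
  then show ?thesis using A by (simp add: brd_def idn_def)
qed

end

section \<open>Hopf objects and convolution\<close>

text \<open>
The setting of the calculations: the consequences of \<open>hopf_object\<close> and \<open>hopf_endomorphism\<close> (defined
below) that they use, restated for typed arrows.
\<close>

locale typed_hopf_object = strict_braided_monoidal_category C
  for C :: "('o, 'm) bmcat" (structure) +
  fixes H :: 'o and \<mu> \<eta> \<Delta> \<epsilon> S \<phi> :: "('o, 'm) arrow"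
  assumes H [simp]: "H \<in> Ob C"
    and hopf_typing [simp]:
      "\<guillemotleft>\<mu> : H \<odot> H \<rightarrow> H\<guillemotright>" "\<guillemotleft>\<eta> : \<I> \<rightarrow> H\<guillemotright>" "\<guillemotleft>\<Delta> : H \<rightarrow> H \<odot> H\<guillemotright>" "\<guillemotleft>\<epsilon> : H \<rightarrow> \<I>\<guillemotright>"
      "\<guillemotleft>S : H \<rightarrow> H\<guillemotright>" "\<guillemotleft>\<phi> : H \<rightarrow> H\<guillemotright>"
    and mult_assoc: "\<mu> \<bullet> (\<mu> \<boxtimes> \<iota> H) = \<mu> \<bullet> (\<iota> H \<boxtimes> \<mu>)"
    and mult_unit: "\<mu> \<bullet> (\<eta> \<boxtimes> \<iota> H) = \<iota> H" "\<mu> \<bullet> (\<iota> H \<boxtimes> \<eta>) = \<iota> H"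
    and comult_assoc: "(\<Delta> \<boxtimes> \<iota> H) \<bullet> \<Delta> = (\<iota> H \<boxtimes> \<Delta>) \<bullet> \<Delta>"
    and comult_unit: "(\<epsilon> \<boxtimes> \<iota> H) \<bullet> \<Delta> = \<iota> H" "(\<iota> H \<boxtimes> \<epsilon>) \<bullet> \<Delta> = \<iota> H"
    and bialgebra:
      "(\<mu> \<boxtimes> \<mu>) \<bullet> (\<iota> H \<boxtimes> \<beta> H H \<boxtimes> \<iota> H) \<bullet> (\<Delta> \<boxtimes> \<Delta>) = \<Delta> \<bullet> \<mu>"
    and counit_mult: "\<epsilon> \<bullet> \<mu> = \<epsilon> \<boxtimes> \<epsilon>"
    and antipode: "\<mu> \<bullet> (S \<boxtimes> \<iota> H) \<bullet> \<Delta> = \<eta> \<bullet> \<epsilon>" "\<mu> \<bullet> (\<iota> H \<boxtimes> S) \<bullet> \<Delta> = \<eta> \<bullet> \<epsilon>"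
    and endo_mult: "\<phi> \<bullet> \<mu> = \<mu> \<bullet> (\<phi> \<boxtimes> \<phi>)"
    and endo_comult: "\<Delta> \<bullet> \<phi> = (\<phi> \<boxtimes> \<phi>) \<bullet> \<Delta>"
    and endo_unit: "\<phi> \<bullet> \<eta> = \<eta>"
    and endo_counit: "\<epsilon> \<bullet> \<phi> = \<epsilon>"
    and endo_antipode: "\<phi> \<bullet> S = S \<bullet> \<phi>"
begin

lemma endo_convolution_inverse:
  "\<mu> \<bullet> (\<phi> \<boxtimes> S \<bullet> \<phi>) \<bullet> \<Delta> = \<eta> \<bullet> \<epsilon>" "\<mu> \<bullet> (S \<bullet> \<phi> \<boxtimes> \<phi>) \<bullet> \<Delta> = \<eta> \<bullet> \<epsilon>"
proof -
  have *: "\<mu> \<bullet> (\<phi> \<boxtimes> \<phi>) \<bullet> f = (\<phi> \<bullet> \<mu>) \<bullet> f" if "arr f" "trg f = H \<odot> H" for f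
    using that by (simp add: endo_mult)
  have "\<mu> \<bullet> (\<phi> \<boxtimes> S \<bullet> \<phi>) \<bullet> \<Delta> = \<mu> \<bullet> (\<phi> \<boxtimes> \<phi>) \<bullet> (\<iota> H \<boxtimes> S) \<bullet> \<Delta>"
    by (simp add: interchange_simps flip: endo_antipode)
  also have "\<dots> = \<phi> \<bullet> \<mu> \<bullet> (\<iota> H \<boxtimes> S) \<bullet> \<Delta>"
    by (simp add: *)
  also have "\<dots> = (\<phi> \<bullet> \<eta>) \<bullet> \<epsilon>" by (simp add: antipode)
  finally show "\<mu> \<bullet> (\<phi> \<boxtimes> S \<bullet> \<phi>) \<bullet> \<Delta> = \<eta> \<bullet> \<epsilon>" by (simp add: endo_unit)
  have "\<mu> \<bullet> (S \<bullet> \<phi> \<boxtimes> \<phi>) \<bullet> \<Delta> = \<mu> \<bullet> (\<phi> \<boxtimes> \<phi>) \<bullet> (S \<boxtimes> \<iota> H) \<bullet> \<Delta>"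
    by (simp add: interchange_simps flip: endo_antipode)
  also have "\<dots> = \<phi> \<bullet> \<mu> \<bullet> (S \<boxtimes> \<iota> H) \<bullet> \<Delta>"
    by (simp add: *)
  also have "\<dots> = (\<phi> \<bullet> \<eta>) \<bullet> \<epsilon>" by (simp add: antipode)
  finally show "\<mu> \<bullet> (S \<bullet> \<phi> \<boxtimes> \<phi>) \<bullet> \<Delta> = \<eta> \<bullet> \<epsilon>" by (simp add: endo_unit)
qed

definition right_action :: "'o \<Rightarrow> ('o, 'm) arrow \<Rightarrow> bool" where
  "right_action V r \<longleftrightarrow> V \<in> Ob C \<and> \<guillemotleft>r : V \<odot> H \<rightarrow> V\<guillemotright> \<and>
     r \<bullet> (r \<boxtimes> \<iota> H) = r \<bullet> (\<iota> V \<boxtimes> \<mu>) \<and> r \<bullet> (\<iota> V \<boxtimes> \<eta>) = \<iota> V"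

definition right_coaction :: "'o \<Rightarrow> ('o, 'm) arrow \<Rightarrow> bool" where
  "right_coaction X k \<longleftrightarrow> X \<in> Ob C \<and> \<guillemotleft>k : X \<rightarrow> X \<odot> H\<guillemotright> \<and>
     (k \<boxtimes> \<iota> H) \<bullet> k = (\<iota> X \<boxtimes> \<Delta>) \<bullet> k \<and> (\<iota> X \<boxtimes> \<epsilon>) \<bullet> k = \<iota> X"

text \<open>
The morphism \<open>r \<bullet> (f \<boxtimes> a) \<bullet> k\<close> is the convolution \<open>f * a\<close> of \<open>f : X \<rightarrow> V\<close> with an endomorphism
\<open>a\<close> of \<open>H\<close>. Together with \<open>convolution_unit\<close> this makes it a right action of the convolution
algebra: the action axiom of \<open>r\<close> and the coaction axiom of \<open>k\<close> regroup \<open>(f(x\<^sub>0) a(x\<^sub>1)) b(x\<^sub>2)\<close>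
as \<open>f(x\<^sub>0) (a(x\<^sub>1) b(x\<^sub>2))\<close>.
\<close>

lemma convolution_assoc:
  assumes r: "right_action V r" and k: "right_coaction X k"
    and t [simp]: "\<guillemotleft>f : X \<rightarrow> V\<guillemotright>" "\<guillemotleft>a : H \<rightarrow> H\<guillemotright>" "\<guillemotleft>b : H \<rightarrow> H\<guillemotright>"
  shows "r \<bullet> (r \<bullet> (f \<boxtimes> a) \<bullet> k \<boxtimes> b) \<bullet> k = r \<bullet> (f \<boxtimes> \<mu> \<bullet> (a \<boxtimes> b) \<bullet> \<Delta>) \<bullet> k"
proof -
  have [simp]: "V \<in> Ob C" "X \<in> Ob C" "\<guillemotleft>r : V \<odot> H \<rightarrow> V\<guillemotright>" "\<guillemotleft>k : X \<rightarrow> X \<odot> H\<guillemotright>"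
    and r': "r \<bullet> (r \<boxtimes> \<iota> H) = r \<bullet> (\<iota> V \<boxtimes> \<mu>)"
    and k': "(k \<boxtimes> \<iota> H) \<bullet> k = (\<iota> X \<boxtimes> \<Delta>) \<bullet> k"
    using r k by (auto simp: right_action_def right_coaction_def)
  have "r \<bullet> (r \<bullet> (f \<boxtimes> a) \<bullet> k \<boxtimes> b) \<bullet> k
      = (r \<bullet> (r \<boxtimes> \<iota> H)) \<bullet> ((f \<boxtimes> a) \<boxtimes> b) \<bullet> ((k \<boxtimes> \<iota> H) \<bullet> k)"
    by (simp add: interchange_simps)
  also have "\<dots> = (r \<bullet> (\<iota> V \<boxtimes> \<mu>)) \<bullet> ((f \<boxtimes> a) \<boxtimes> b) \<bullet> ((\<iota> X \<boxtimes> \<Delta>) \<bullet> k)"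
    by (simp only: r' k')
  also have "\<dots> = r \<bullet> (f \<boxtimes> \<mu> \<bullet> (a \<boxtimes> b) \<bullet> \<Delta>) \<bullet> k"
    by (simp add: interchange_simps)
  finally show ?thesis .
qed

lemma convolution_unit:
  assumes r: "right_action V r" and k: "right_coaction X k" and t [simp]: "\<guillemotleft>f : X \<rightarrow> V\<guillemotright>"
  shows "r \<bullet> (f \<boxtimes> \<eta> \<bullet> \<epsilon>) \<bullet> k = f"
proof -
  have [simp]: "V \<in> Ob C" "X \<in> Ob C" "\<guillemotleft>r : V \<odot> H \<rightarrow> V\<guillemotright>" "\<guillemotleft>k : X \<rightarrow> X \<odot> H\<guillemotright>"
    and r': "r \<bullet> (\<iota> V \<boxtimes> \<eta>) = \<iota> V" and k': "(\<iota> X \<boxtimes> \<epsilon>) \<bullet> k = \<iota> X"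
    using r k by (auto simp: right_action_def right_coaction_def)
  have *: "(\<iota> V \<boxtimes> \<eta>) \<bullet> f \<bullet> (\<iota> X \<boxtimes> \<epsilon>) = f \<boxtimes> \<eta> \<bullet> \<epsilon>"
    using ten_cmp[of f "\<iota> \<I>" "\<iota> X" \<epsilon>] ten_cmp[of "\<iota> V" \<eta> f \<epsilon>] by simp
  have "r \<bullet> (f \<boxtimes> \<eta> \<bullet> \<epsilon>) \<bullet> k = (r \<bullet> (\<iota> V \<boxtimes> \<eta>)) \<bullet> f \<bullet> ((\<iota> X \<boxtimes> \<epsilon>) \<bullet> k)"
    by (simp flip: *)
  also have "\<dots> = f" by (simp only: r' k') simp
  finally show ?thesis .
qed

text \<open>
Convolving once more with \<open>S \<bullet> \<phi>\<close> recovers \<open>f\<close>.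
\<close>

lemma convolution_cancel:
  assumes "right_action V r" "right_coaction X k" "\<guillemotleft>f : X \<rightarrow> V\<guillemotright>" "\<guillemotleft>g : X \<rightarrow> V\<guillemotright>"
    and eq: "r \<bullet> (f \<boxtimes> \<phi>) \<bullet> k = r \<bullet> (g \<boxtimes> \<phi>) \<bullet> k"
  shows "f = g"
proof -
  have "r \<bullet> (r \<bullet> (h \<boxtimes> \<phi>) \<bullet> k \<boxtimes> S \<bullet> \<phi>) \<bullet> k = h" if "\<guillemotleft>h : X \<rightarrow> V\<guillemotright>" for h
    using convolution_assoc[OF assms(1,2) that, of \<phi> "S \<bullet> \<phi>"] convolution_unit[OF assms(1,2) that]
    by (simp add: endo_convolution_inverse)
  then show ?thesis using assms by metis
qed

section \<open>The action of H on H tensor V\<close>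

text \<open>
The right action \<open>(a \<otimes> v) h = a h \<otimes> v\<close> of \<open>H\<close> on \<open>H \<otimes> V\<close>.
\<close>

definition shift_act :: "'o \<Rightarrow> ('o, 'm) arrow" where
  "shift_act V = (\<mu> \<boxtimes> \<iota> V) \<bullet> (\<iota> H \<boxtimes> \<beta> V H)"

lemma shift_act_typing [simp]:
  "V \<in> Ob C \<Longrightarrow> arr (shift_act V)"
  "V \<in> Ob C \<Longrightarrow> src (shift_act V) = H \<odot> V \<odot> H"
  "V \<in> Ob C \<Longrightarrow> trg (shift_act V) = H \<odot> V"
  by (simp_all add: shift_act_def)

text \<open>
Acting by \<open>h\<close> and then by \<open>k\<close> crosses \<open>V\<close> twice; by the hexagon and naturality this is one crossing
with the product \<open>h k\<close>, and the rest is associativity of the product.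
\<close>

lemma right_action_shift:
  assumes [simp]: "V \<in> Ob C"
  shows "right_action (H \<odot> V) (shift_act V)"
proof -
  let ?r = "shift_act V"
  have "?r \<bullet> (?r \<boxtimes> \<iota> H) = (\<mu> \<boxtimes> \<iota> V) \<bullet> ((\<iota> H \<boxtimes> \<beta> V H) \<bullet> (\<mu> \<boxtimes> \<iota> V \<boxtimes> \<iota> H)) \<bullet> (\<iota> H \<boxtimes> \<beta> V H \<boxtimes> \<iota> H)"
    by (simp add: shift_act_def whisker)
  also have "(\<iota> H \<boxtimes> \<beta> V H) \<bullet> (\<mu> \<boxtimes> \<iota> V \<boxtimes> \<iota> H) = (\<mu> \<boxtimes> \<iota> H \<boxtimes> \<iota> V) \<bullet> (\<iota> H \<boxtimes> \<iota> H \<boxtimes> \<beta> V H)"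
    using slide[of \<mu> "\<beta> V H"] by simp
  also have "(\<mu> \<boxtimes> \<iota> V) \<bullet> ((\<mu> \<boxtimes> \<iota> H \<boxtimes> \<iota> V) \<bullet> (\<iota> H \<boxtimes> \<iota> H \<boxtimes> \<beta> V H)) \<bullet> (\<iota> H \<boxtimes> \<beta> V H \<boxtimes> \<iota> H)
      = (\<mu> \<bullet> (\<mu> \<boxtimes> \<iota> H) \<boxtimes> \<iota> V) \<bullet> (\<iota> H \<boxtimes> \<beta> V (H \<odot> H))"
    by (simp add: hexagons whisker)
  also have "\<dots> = (\<mu> \<boxtimes> \<iota> V) \<bullet> (\<iota> H \<boxtimes> (\<mu> \<boxtimes> \<iota> V) \<bullet> \<beta> V (H \<odot> H))"
    by (simp add: mult_assoc whisker)
  also have "(\<mu> \<boxtimes> \<iota> V) \<bullet> \<beta> V (H \<odot> H) = \<beta> V H \<bullet> (\<iota> V \<boxtimes> \<mu>)"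
    using braid_natural[of "\<iota> V" \<mu>] by simp
  also have "(\<mu> \<boxtimes> \<iota> V) \<bullet> (\<iota> H \<boxtimes> \<beta> V H \<bullet> (\<iota> V \<boxtimes> \<mu>)) = ?r \<bullet> (\<iota> (H \<odot> V) \<boxtimes> \<mu>)"
    by (simp add: shift_act_def interchange_simps)
  finally have assoc: "?r \<bullet> (?r \<boxtimes> \<iota> H) = ?r \<bullet> (\<iota> (H \<odot> V) \<boxtimes> \<mu>)" .
  have "?r \<bullet> (\<iota> (H \<odot> V) \<boxtimes> \<eta>) = (\<mu> \<boxtimes> \<iota> V) \<bullet> (\<iota> H \<boxtimes> \<beta> V H \<bullet> (\<iota> V \<boxtimes> \<eta>))"
    by (simp add: shift_act_def interchange_simps)
  also have "\<beta> V H \<bullet> (\<iota> V \<boxtimes> \<eta>) = \<eta> \<boxtimes> \<iota> V"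
    using braid_natural[of "\<iota> V" \<eta>] by (simp add: braid_unit)
  also have "(\<mu> \<boxtimes> \<iota> V) \<bullet> (\<iota> H \<boxtimes> \<eta> \<boxtimes> \<iota> V) = \<iota> (H \<odot> V)"
    by (simp add: interchange_simps mult_unit)
  finally show ?thesis using assoc unfolding right_action_def by simp
qed

lemma right_action_pad:
  assumes r: "right_action V r" and [simp]: "U \<in> Ob C"
  shows "right_action (U \<odot> V) (\<iota> U \<boxtimes> r)"
  using r by (auto simp: right_action_def interchange_simps)

lemma right_coaction_comult: "right_coaction H \<Delta>"
  by (simp add: right_coaction_def comult_assoc comult_unit)

lemma right_coaction_pad: "U \<in> Ob C \<Longrightarrow> right_coaction (U \<odot> H) (\<iota> U \<boxtimes> \<Delta>)"
  by (simp add: right_coaction_def interchange_simps comult_assoc comult_unit)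

lemma shift_act_natural:
  assumes f [simp]: "\<guillemotleft>f : V \<rightarrow> W\<guillemotright>" and V [simp]: "V \<in> Ob C"
  shows "shift_act W \<bullet> (\<iota> H \<boxtimes> f \<boxtimes> \<iota> H) = (\<iota> H \<boxtimes> f) \<bullet> shift_act V"
proof -
  have [simp]: "W \<in> Ob C" using f ob_simps(2) by blast
  have "shift_act W \<bullet> (\<iota> H \<boxtimes> f \<boxtimes> \<iota> H) = (\<mu> \<boxtimes> \<iota> W) \<bullet> (\<iota> H \<boxtimes> \<beta> W H \<bullet> (f \<boxtimes> \<iota> H))"
    by (simp add: shift_act_def whisker)
  also have "\<beta> W H \<bullet> (f \<boxtimes> \<iota> H) = (\<iota> H \<boxtimes> f) \<bullet> \<beta> V H"
    using braid_natural[of f "\<iota> H"] by simp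
  also have "(\<mu> \<boxtimes> \<iota> W) \<bullet> (\<iota> H \<boxtimes> (\<iota> H \<boxtimes> f) \<bullet> \<beta> V H) = ((\<mu> \<boxtimes> \<iota> W) \<bullet> (\<iota> H \<boxtimes> \<iota> H \<boxtimes> f)) \<bullet> (\<iota> H \<boxtimes> \<beta> V H)"
    by (simp add: whisker)
  also have "\<dots> = (\<iota> H \<boxtimes> f) \<bullet> shift_act V"
    by (simp add: shift_act_def interchange_simps)
  finally show ?thesis .
qed

text \<open>
The product of the braided tensor square of the algebra \<open>H\<close>.
\<close>

definition square_mult :: "('o, 'm) arrow" where
  "square_mult = (\<mu> \<boxtimes> \<mu>) \<bullet> (\<iota> H \<boxtimes> \<beta> H H \<boxtimes> \<iota> H)"

lemma square_mult_typing [simp]: "\<guillemotleft>square_mult : H \<odot> H \<odot> H \<odot> H \<rightarrow> H \<odot> H\<guillemotright>"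
  by (simp add: square_mult_def)

text \<open>
\<open>shift_act H\<close> is right multiplication by \<open>h \<otimes> 1\<close> in the tensor square, so it commutes with left
multiplications. On strands the two sides for \<open>(a \<otimes> b) (c \<otimes> d) h = a c h \<otimes> b d\<close> differ only in
whether \<open>b\<close> crosses \<open>c\<close> before or after \<open>h\<close> crosses \<open>d\<close>; these crossings are disjoint.
\<close>

lemma shift_act_square_mult:
  "shift_act H \<bullet> (square_mult \<boxtimes> \<iota> H) = square_mult \<bullet> (\<iota> H \<boxtimes> \<iota> H \<boxtimes> shift_act H)"
proof -
  \<comment> \<open>Factorisations into layers, the converse direction of the interchange law.\<close>
  have e1: "\<mu> \<boxtimes> (\<iota> H \<boxtimes> \<mu>) \<bullet> \<beta> (H \<odot> H) H = (\<mu> \<boxtimes> \<iota> H \<boxtimes> \<mu>) \<bullet> (\<iota> H \<boxtimes> \<iota> H \<boxtimes> \<beta> (H \<odot> H) H)"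
    using ten_cmp[of \<mu> "\<iota> H \<boxtimes> \<mu>" "\<iota> H \<boxtimes> \<iota> H" "\<beta> (H \<odot> H) H"] by simp
  have e2: "\<mu> \<bullet> (\<mu> \<boxtimes> \<iota> H) \<boxtimes> \<mu> = (\<mu> \<boxtimes> \<iota> H) \<bullet> (\<mu> \<boxtimes> \<iota> H \<boxtimes> \<mu>)"
    and e3: "\<mu> \<bullet> (\<iota> H \<boxtimes> \<mu>) \<boxtimes> \<mu> = (\<mu> \<boxtimes> \<mu>) \<bullet> (\<iota> H \<boxtimes> \<mu> \<boxtimes> \<iota> H \<boxtimes> \<iota> H)"
    by (simp_all add: interchange_simps)
  have "shift_act H \<bullet> (square_mult \<boxtimes> \<iota> H)
      = (\<mu> \<boxtimes> \<iota> H) \<bullet> (\<mu> \<boxtimes> \<beta> H H \<bullet> (\<mu> \<boxtimes> \<iota> H)) \<bullet> (\<iota> H \<boxtimes> \<beta> H H \<boxtimes> \<iota> H \<boxtimes> \<iota> H)"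
    by (simp add: shift_act_def square_mult_def interchange_simps whisker(1))
  also have "\<beta> H H \<bullet> (\<mu> \<boxtimes> \<iota> H) = (\<iota> H \<boxtimes> \<mu>) \<bullet> \<beta> (H \<odot> H) H"
    using braid_natural[of \<mu> "\<iota> H"] by simp
  also have "(\<mu> \<boxtimes> \<iota> H) \<bullet> (\<mu> \<boxtimes> (\<iota> H \<boxtimes> \<mu>) \<bullet> \<beta> (H \<odot> H) H) \<bullet> (\<iota> H \<boxtimes> \<beta> H H \<boxtimes> \<iota> H \<boxtimes> \<iota> H)
      = ((\<mu> \<bullet> (\<mu> \<boxtimes> \<iota> H)) \<boxtimes> \<mu>) \<bullet> (\<iota> H \<boxtimes> (\<iota> H \<boxtimes> \<beta> (H \<odot> H) H) \<bullet> (\<beta> H H \<boxtimes> \<iota> H \<boxtimes> \<iota> H))"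
    unfolding e1 e2 by (simp add: whisker)
  \<comment> \<open>The disjoint crossings: split the double crossing by the hexagon, slide, and recombine.\<close>
  also have "(\<iota> H \<boxtimes> \<beta> (H \<odot> H) H) \<bullet> (\<beta> H H \<boxtimes> \<iota> H \<boxtimes> \<iota> H) = (\<beta> H (H \<odot> H) \<boxtimes> \<iota> H) \<bullet> (\<iota> H \<boxtimes> \<iota> H \<boxtimes> \<beta> H H)"
    using slide[of "\<beta> H H" "\<beta> H H"] by (simp add: hexagons whisker)
  also have "(\<mu> \<bullet> (\<mu> \<boxtimes> \<iota> H) \<boxtimes> \<mu>) \<bullet> (\<iota> H \<boxtimes> (\<beta> H (H \<odot> H) \<boxtimes> \<iota> H) \<bullet> (\<iota> H \<boxtimes> \<iota> H \<boxtimes> \<beta> H H))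
      = (\<mu> \<boxtimes> \<mu>) \<bullet> (\<iota> H \<boxtimes> ((\<mu> \<boxtimes> \<iota> H) \<bullet> \<beta> H (H \<odot> H)) \<boxtimes> \<iota> H) \<bullet> (\<iota> H \<boxtimes> \<iota> H \<boxtimes> \<iota> H \<boxtimes> \<beta> H H)"
    unfolding mult_assoc e3 by (simp add: whisker)
  also have "(\<mu> \<boxtimes> \<iota> H) \<bullet> \<beta> H (H \<odot> H) = \<beta> H H \<bullet> (\<iota> H \<boxtimes> \<mu>)"
    using braid_natural[of "\<iota> H" \<mu>] by simp
  also have "(\<mu> \<boxtimes> \<mu>) \<bullet> (\<iota> H \<boxtimes> (\<beta> H H \<bullet> (\<iota> H \<boxtimes> \<mu>)) \<boxtimes> \<iota> H) \<bullet> (\<iota> H \<boxtimes> \<iota> H \<boxtimes> \<iota> H \<boxtimes> \<beta> H H)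
     = square_mult \<bullet> (\<iota> H \<boxtimes> \<iota> H \<boxtimes> shift_act H)"
    by (simp add: shift_act_def square_mult_def whisker)
  finally show ?thesis .
qed

text \<open>
As \<open>\<Delta>\<close> is multiplicative, \<open>\<Delta>(a h) \<otimes> v = (a\<^sub>1 h\<^sub>1 \<otimes> a\<^sub>2 h\<^sub>2) \<otimes> v\<close>. The left side acts with \<open>h\<^sub>1\<close> on the
first tensor factor and with \<open>h\<^sub>2\<close> on the second one.
\<close>

lemma shift_act_comult:
  "(\<iota> H \<boxtimes> shift_act H) \<bullet> (shift_act (H \<odot> H) \<boxtimes> \<iota> H) \<bullet> (\<Delta> \<boxtimes> \<iota> H \<boxtimes> \<Delta>) = (\<Delta> \<boxtimes> \<iota> H) \<bullet> shift_act H"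
proof -
  have far: "(\<iota> H \<boxtimes> \<iota> H \<boxtimes> \<iota> H \<boxtimes> \<beta> H H) \<bullet> (\<iota> H \<boxtimes> \<beta> H H \<boxtimes> \<iota> H \<boxtimes> \<iota> H)
      = (\<iota> H \<boxtimes> \<beta> H H \<boxtimes> \<iota> H \<boxtimes> \<iota> H) \<bullet> (\<iota> H \<boxtimes> \<iota> H \<boxtimes> \<iota> H \<boxtimes> \<beta> H H)"
    using slide[of "\<iota> H \<boxtimes> \<beta> H H" "\<beta> H H"] by simp
  have "(\<iota> H \<boxtimes> shift_act H) \<bullet> (shift_act (H \<odot> H) \<boxtimes> \<iota> H) \<bullet> (\<Delta> \<boxtimes> \<iota> H \<boxtimes> \<Delta>)
      = (\<iota> H \<boxtimes> \<mu> \<boxtimes> \<iota> H) \<bullet> ((\<iota> H \<boxtimes> \<iota> H \<boxtimes> \<beta> H H) \<bullet> (\<mu> \<boxtimes> \<iota> H \<boxtimes> \<iota> H \<boxtimes> \<iota> H))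
          \<bullet> (\<iota> H \<boxtimes> \<beta> (H \<odot> H) H \<boxtimes> \<iota> H) \<bullet> (\<Delta> \<boxtimes> \<iota> H \<boxtimes> \<Delta>)"
    by (simp add: shift_act_def whisker)
  also have "(\<iota> H \<boxtimes> \<iota> H \<boxtimes> \<beta> H H) \<bullet> (\<mu> \<boxtimes> \<iota> H \<boxtimes> \<iota> H \<boxtimes> \<iota> H)
      = (\<mu> \<boxtimes> \<iota> H \<boxtimes> \<iota> H \<boxtimes> \<iota> H) \<bullet> (\<iota> H \<boxtimes> \<iota> H \<boxtimes> \<iota> H \<boxtimes> \<beta> H H)"
    using slide[of \<mu> "\<iota> H \<boxtimes> \<beta> H H"] by simp
  also have "(\<iota> H \<boxtimes> \<mu> \<boxtimes> \<iota> H) \<bullet> ((\<mu> \<boxtimes> \<iota> H \<boxtimes> \<iota> H \<boxtimes> \<iota> H) \<bullet> (\<iota> H \<boxtimes> \<iota> H \<boxtimes> \<iota> H \<boxtimes> \<beta> H H))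
          \<bullet> (\<iota> H \<boxtimes> \<beta> (H \<odot> H) H \<boxtimes> \<iota> H) \<bullet> (\<Delta> \<boxtimes> \<iota> H \<boxtimes> \<Delta>)
      = ((\<iota> H \<boxtimes> \<mu> \<boxtimes> \<iota> H) \<bullet> (\<mu> \<boxtimes> \<iota> H \<boxtimes> \<iota> H \<boxtimes> \<iota> H))
          \<bullet> ((\<iota> H \<boxtimes> \<iota> H \<boxtimes> \<iota> H \<boxtimes> \<beta> H H) \<bullet> (\<iota> H \<boxtimes> \<beta> (H \<odot> H) H \<boxtimes> \<iota> H)) \<bullet> (\<Delta> \<boxtimes> \<iota> H \<boxtimes> \<Delta>)"
    by simp
  also have "(\<iota> H \<boxtimes> \<mu> \<boxtimes> \<iota> H) \<bullet> (\<mu> \<boxtimes> \<iota> H \<boxtimes> \<iota> H \<boxtimes> \<iota> H) = \<mu> \<boxtimes> \<mu> \<boxtimes> \<iota> H"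
    by (simp add: interchange_simps)
  also have "(\<iota> H \<boxtimes> \<iota> H \<boxtimes> \<iota> H \<boxtimes> \<beta> H H) \<bullet> (\<iota> H \<boxtimes> \<beta> (H \<odot> H) H \<boxtimes> \<iota> H)
      = (\<iota> H \<boxtimes> \<beta> H H \<boxtimes> \<iota> H \<boxtimes> \<iota> H) \<bullet> (\<iota> H \<boxtimes> \<iota> H \<boxtimes> \<beta> H (H \<odot> H))"
    by (simp add: hexagons whisker cmp_eq_chain[OF far])
  also have "(\<mu> \<boxtimes> \<mu> \<boxtimes> \<iota> H) \<bullet> ((\<iota> H \<boxtimes> \<beta> H H \<boxtimes> \<iota> H \<boxtimes> \<iota> H) \<bullet> (\<iota> H \<boxtimes> \<iota> H \<boxtimes> \<beta> H (H \<odot> H)))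
          \<bullet> (\<Delta> \<boxtimes> \<iota> H \<boxtimes> \<Delta>)
      = ((\<mu> \<boxtimes> \<mu> \<boxtimes> \<iota> H) \<bullet> (\<iota> H \<boxtimes> \<beta> H H \<boxtimes> \<iota> H \<boxtimes> \<iota> H))
          \<bullet> ((\<iota> H \<boxtimes> \<iota> H \<boxtimes> \<beta> H (H \<odot> H)) \<bullet> (\<Delta> \<boxtimes> \<iota> H \<boxtimes> \<Delta>))"
    by simp
  also have "(\<mu> \<boxtimes> \<mu> \<boxtimes> \<iota> H) \<bullet> (\<iota> H \<boxtimes> \<beta> H H \<boxtimes> \<iota> H \<boxtimes> \<iota> H) = square_mult \<boxtimes> \<iota> H"
    by (simp add: square_mult_def whisker(1))
  also have "(\<iota> H \<boxtimes> \<iota> H \<boxtimes> \<beta> H (H \<odot> H)) \<bullet> (\<Delta> \<boxtimes> \<iota> H \<boxtimes> \<Delta>)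
      = \<Delta> \<boxtimes> \<beta> H (H \<odot> H) \<bullet> (\<iota> H \<boxtimes> \<Delta>)"
    by (simp add: interchange_simps)
  also have "\<beta> H (H \<odot> H) \<bullet> (\<iota> H \<boxtimes> \<Delta>) = (\<Delta> \<boxtimes> \<iota> H) \<bullet> \<beta> H H"
    using braid_natural[of "\<iota> H" \<Delta>] by simp
  also have "\<Delta> \<boxtimes> (\<Delta> \<boxtimes> \<iota> H) \<bullet> \<beta> H H = (\<Delta> \<boxtimes> \<Delta> \<boxtimes> \<iota> H) \<bullet> (\<iota> H \<boxtimes> \<beta> H H)"
    by (simp add: interchange_simps)
  also have "(square_mult \<boxtimes> \<iota> H) \<bullet> (\<Delta> \<boxtimes> \<Delta> \<boxtimes> \<iota> H) \<bullet> (\<iota> H \<boxtimes> \<beta> H H)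
      = ((square_mult \<bullet> (\<Delta> \<boxtimes> \<Delta>)) \<boxtimes> \<iota> H) \<bullet> (\<iota> H \<boxtimes> \<beta> H H)"
    by (simp add: whisker)
  also have "\<dots> = (\<Delta> \<boxtimes> \<iota> H) \<bullet> shift_act H"
    by (simp add: square_mult_def shift_act_def bialgebra whisker(1))
  finally show ?thesis .
qed

lemma shift_act_counit: "(\<epsilon> \<boxtimes> \<iota> H) \<bullet> shift_act H = \<epsilon> \<boxtimes> \<iota> H \<boxtimes> \<epsilon>"
proof -
  have "(\<epsilon> \<boxtimes> \<iota> H) \<bullet> shift_act H = (\<epsilon> \<boxtimes> \<epsilon> \<boxtimes> \<iota> H) \<bullet> (\<iota> H \<boxtimes> \<beta> H H)"
    by (simp add: shift_act_def interchange_simps counit_mult)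
  also have "\<dots> = \<epsilon> \<boxtimes> (\<epsilon> \<boxtimes> \<iota> H) \<bullet> \<beta> H H"
    using ten_cmp[of \<epsilon> "\<epsilon> \<boxtimes> \<iota> H" "\<iota> H" "\<beta> H H"] by simp
  also have "(\<epsilon> \<boxtimes> \<iota> H) \<bullet> \<beta> H H = \<iota> H \<boxtimes> \<epsilon>"
    using braid_natural[of "\<iota> H" \<epsilon>] by (simp add: braid_unit)
  finally show ?thesis .
qed

section \<open>The twisted adjoint coaction\<close>

text \<open>
The coaction \<open>x \<mapsto> x\<^sub>1 S\<phi>(x\<^sub>3) \<otimes> x\<^sub>2\<close>, written as the convolution of \<open>\<Delta>\<close> with \<open>S \<bullet> \<phi>\<close>.
\<close>

definition adjoint_coaction :: "('o, 'm) arrow" where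
  "adjoint_coaction = shift_act H \<bullet> (\<Delta> \<boxtimes> S \<bullet> \<phi>) \<bullet> \<Delta>"

lemma adjoint_coaction_typing [simp]: "\<guillemotleft>adjoint_coaction : H \<rightarrow> H \<odot> H\<guillemotright>"
  by (simp add: adjoint_coaction_def)

lemma adjoint_coaction_convolution: "shift_act H \<bullet> (adjoint_coaction \<boxtimes> \<phi>) \<bullet> \<Delta> = \<Delta>"
  using convolution_assoc[OF right_action_shift[OF H] right_coaction_comult, of \<Delta> "S \<bullet> \<phi>" \<phi>]
    convolution_unit[OF right_action_shift[OF H] right_coaction_comult, of \<Delta>]
  by (simp add: adjoint_coaction_def endo_convolution_inverse)

text \<open>
Apply \<open>\<epsilon> \<otimes> 1\<close> to \<open>\<delta>(x\<^sub>1) \<phi>(x\<^sub>2) = \<Delta>(x)\<close>: the counit is multiplicative and ignores \<open>\<phi>\<close>.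
\<close>

lemma adjoint_coaction_counit: "(\<epsilon> \<boxtimes> \<iota> H) \<bullet> adjoint_coaction = \<iota> H"
proof -
  have "\<iota> H = (\<epsilon> \<boxtimes> \<iota> H) \<bullet> shift_act H \<bullet> (adjoint_coaction \<boxtimes> \<phi>) \<bullet> \<Delta>"
    by (simp only: adjoint_coaction_convolution comult_unit)
  also have "\<dots> = ((\<epsilon> \<boxtimes> \<iota> H) \<bullet> shift_act H) \<bullet> (adjoint_coaction \<boxtimes> \<phi>) \<bullet> \<Delta>" by simp
  also have "\<dots> = ((\<epsilon> \<boxtimes> \<iota> H) \<bullet> adjoint_coaction \<boxtimes> \<epsilon>) \<bullet> \<Delta>"
    by (simp only: shift_act_counit) (simp add: interchange_simps endo_counit)
  also have "\<dots> = ((\<epsilon> \<boxtimes> \<iota> H) \<bullet> adjoint_coaction) \<bullet> ((\<iota> H \<boxtimes> \<epsilon>) \<bullet> \<Delta>)"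
    using ten_cmp[of "(\<epsilon> \<boxtimes> \<iota> H) \<bullet> adjoint_coaction" "\<iota> \<I>" "\<iota> H" \<epsilon>] by (simp flip: cmp_assoc)
  finally show ?thesis by (simp add: comult_unit)
qed

text \<open>
Let \<open>\<phi>(x\<^sub>2)\<close> act on the first tensor factor and \<open>\<phi>(x\<^sub>3)\<close> on the second. On the left side these two
actions are one diagonal action on \<open>(\<Delta> \<otimes> 1) \<delta>(x\<^sub>1)\<close> (\<open>shift_act_comult\<close>), so the result is
\<open>(\<Delta> \<otimes> 1) \<Delta>(x)\<close>. On the right side the first action passes through \<open>1 \<otimes> \<delta>\<close> and gives
\<open>x\<^sub>1 \<otimes> \<delta>(x\<^sub>2)\<close>, which the second one turns into \<open>x\<^sub>1 \<otimes> \<Delta>(x\<^sub>2)\<close>.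
\<close>

lemma adjoint_coaction_coassoc:
  "(\<Delta> \<boxtimes> \<iota> H) \<bullet> adjoint_coaction = (\<iota> H \<boxtimes> adjoint_coaction) \<bullet> adjoint_coaction" (is "?f = ?g")
proof (rule convolution_cancel[OF right_action_shift right_coaction_comult])
  show "shift_act (H \<odot> H) \<bullet> (?f \<boxtimes> \<phi>) \<bullet> \<Delta> = shift_act (H \<odot> H) \<bullet> (?g \<boxtimes> \<phi>) \<bullet> \<Delta>" (is "?f' = ?g'")
  proof (rule convolution_cancel[OF right_action_pad[OF right_action_shift] right_coaction_comult])
    have "(\<iota> H \<boxtimes> shift_act H) \<bullet> (?f' \<boxtimes> \<phi>) \<bullet> \<Delta>
       = (\<iota> H \<boxtimes> shift_act H) \<bullet> (shift_act (H \<odot> H) \<boxtimes> \<iota> H) \<bullet> (((\<Delta> \<boxtimes> \<iota> H) \<bullet> adjoint_coaction) \<boxtimes> \<phi> \<boxtimes> \<phi>) \<bullet> ((\<Delta> \<boxtimes> \<iota> H) \<bullet> \<Delta>)"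
      by (simp add: interchange_simps)
    also have "\<dots> = (\<iota> H \<boxtimes> shift_act H) \<bullet> (shift_act (H \<odot> H) \<boxtimes> \<iota> H) \<bullet> (((\<Delta> \<boxtimes> \<iota> H) \<bullet> adjoint_coaction) \<boxtimes> ((\<phi> \<boxtimes> \<phi>) \<bullet> \<Delta>)) \<bullet> \<Delta>"
      unfolding comult_assoc by (simp add: interchange_simps)
    also have "\<dots> = ((\<iota> H \<boxtimes> shift_act H) \<bullet> (shift_act (H \<odot> H) \<boxtimes> \<iota> H) \<bullet> (\<Delta> \<boxtimes> \<iota> H \<boxtimes> \<Delta>)) \<bullet> (adjoint_coaction \<boxtimes> \<phi>) \<bullet> \<Delta>"
      by (simp add: interchange_simps flip: endo_comult)
    also have "\<dots> = (\<Delta> \<boxtimes> \<iota> H) \<bullet> (shift_act H \<bullet> (adjoint_coaction \<boxtimes> \<phi>) \<bullet> \<Delta>)"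
      by (simp add: shift_act_comult)
    finally have f: "(\<iota> H \<boxtimes> shift_act H) \<bullet> (?f' \<boxtimes> \<phi>) \<bullet> \<Delta> = (\<iota> H \<boxtimes> \<Delta>) \<bullet> \<Delta>"
      by (simp add: adjoint_coaction_convolution comult_assoc)
    have "?g' = (shift_act (H \<odot> H) \<bullet> (\<iota> H \<boxtimes> adjoint_coaction \<boxtimes> \<iota> H)) \<bullet> (adjoint_coaction \<boxtimes> \<phi>) \<bullet> \<Delta>"
      by (simp add: interchange_simps)
    also have "\<dots> = (\<iota> H \<boxtimes> adjoint_coaction) \<bullet> (shift_act H \<bullet> (adjoint_coaction \<boxtimes> \<phi>) \<bullet> \<Delta>)"
      by (simp add: shift_act_natural)
    finally have g': "?g' = (\<iota> H \<boxtimes> adjoint_coaction) \<bullet> \<Delta>" by (simp only: adjoint_coaction_convolution)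
    have "(\<iota> H \<boxtimes> shift_act H) \<bullet> (?g' \<boxtimes> \<phi>) \<bullet> \<Delta>
        = (\<iota> H \<boxtimes> shift_act H) \<bullet> (\<iota> H \<boxtimes> adjoint_coaction \<boxtimes> \<phi>) \<bullet> ((\<Delta> \<boxtimes> \<iota> H) \<bullet> \<Delta>)"
      unfolding g' by (simp add: interchange_simps)
    also have "\<dots> = (\<iota> H \<boxtimes> shift_act H \<bullet> (adjoint_coaction \<boxtimes> \<phi>) \<bullet> \<Delta>) \<bullet> \<Delta>"
      unfolding comult_assoc by (simp add: interchange_simps)
    finally show "(\<iota> H \<boxtimes> shift_act H) \<bullet> (?f' \<boxtimes> \<phi>) \<bullet> \<Delta> = (\<iota> H \<boxtimes> shift_act H) \<bullet> (?g' \<boxtimes> \<phi>) \<bullet> \<Delta>"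
      unfolding f adjoint_coaction_convolution by simp
  qed simp_all
qed simp_all

text \<open>
The condition is \<open>\<delta>(h\<^sub>1 y) \<phi>(h\<^sub>2) = \<Delta>(h) \<delta>(y)\<close>. Convolving with \<open>\<phi>\<close> in the variable \<open>y\<close> gives
\<open>\<delta>(h\<^sub>1 y\<^sub>1) \<phi>(h\<^sub>2) \<phi>(y\<^sub>2) = \<delta>(h\<^sub>1 y\<^sub>1) \<phi>(h\<^sub>2 y\<^sub>2) = \<Delta>(h y)\<close> on the left, and
\<open>\<Delta>(h) \<delta>(y\<^sub>1) \<phi>(y\<^sub>2) = \<Delta>(h) \<Delta>(y)\<close> on the right.
\<close>

lemma adjoint_coaction_yetter_drinfeld:
  "shift_act H \<bullet> (adjoint_coaction \<bullet> \<mu> \<boxtimes> \<phi>) \<bullet> (\<iota> H \<boxtimes> \<beta> H H) \<bullet> (\<Delta> \<boxtimes> \<iota> H)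
    = square_mult \<bullet> (\<Delta> \<boxtimes> adjoint_coaction)" (is "?l = ?r")
proof (rule convolution_cancel[OF right_action_shift right_coaction_pad])
  let ?s = "shift_act H"
  have act: "?s \<bullet> (?s \<boxtimes> \<iota> H) = ?s \<bullet> (\<iota> (H \<odot> H) \<boxtimes> \<mu>)"
    using right_action_shift[OF H] by (simp add: right_action_def)
  \<comment> \<open>In the right-hand side of \<open>e\<close> the coproduct of \<open>y\<close> comes first, as in the convolution.\<close>
  have e: "\<Delta> \<boxtimes> \<Delta> = (\<Delta> \<boxtimes> \<iota> H \<boxtimes> \<iota> H) \<bullet> (\<iota> H \<boxtimes> \<Delta>)"
    by (simp add: interchange_simps)
  have e': "(adjoint_coaction \<bullet> \<mu> \<boxtimes> \<phi> \<boxtimes> \<phi>) \<bullet> (\<iota> H \<boxtimes> \<beta> H H \<boxtimes> \<iota> H) \<bullet> (\<Delta> \<boxtimes> \<iota> H \<boxtimes> \<iota> H)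
      = (adjoint_coaction \<bullet> \<mu> \<boxtimes> \<phi>) \<bullet> (\<iota> H \<boxtimes> \<beta> H H) \<bullet> (\<Delta> \<boxtimes> \<iota> H) \<boxtimes> \<phi>"
    by (simp add: interchange_simps)
  have e3: "(\<iota> H \<boxtimes> \<iota> H \<boxtimes> \<mu>) \<bullet> (adjoint_coaction \<bullet> \<mu> \<boxtimes> \<phi> \<boxtimes> \<phi>) = (adjoint_coaction \<boxtimes> \<phi>) \<bullet> (\<mu> \<boxtimes> \<mu>)"
    by (simp add: interchange_simps endo_mult)
  have e2: "?r \<boxtimes> \<phi> = (square_mult \<boxtimes> \<iota> H) \<bullet> (\<Delta> \<boxtimes> adjoint_coaction \<boxtimes> \<phi>)"
    by (simp add: interchange_simps)
  have "?s \<bullet> (?l \<boxtimes> \<phi>) \<bullet> (\<iota> H \<boxtimes> \<Delta>)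
      = (?s \<bullet> (?s \<boxtimes> \<iota> H)) \<bullet> ((adjoint_coaction \<bullet> \<mu> \<boxtimes> \<phi>) \<bullet> (\<iota> H \<boxtimes> \<beta> H H) \<bullet> (\<Delta> \<boxtimes> \<iota> H) \<boxtimes> \<phi>) \<bullet> (\<iota> H \<boxtimes> \<Delta>)"
    by (simp add: interchange_simps)
  also have "\<dots> = (?s \<bullet> (?s \<boxtimes> \<iota> H)) \<bullet> (adjoint_coaction \<bullet> \<mu> \<boxtimes> \<phi> \<boxtimes> \<phi>) \<bullet> (\<iota> H \<boxtimes> \<beta> H H \<boxtimes> \<iota> H) \<bullet> (\<Delta> \<boxtimes> \<Delta>)"
    unfolding e e'[symmetric] by simp
  also have "\<dots> = (?s \<bullet> (\<iota> (H \<odot> H) \<boxtimes> \<mu>)) \<bullet> (adjoint_coaction \<bullet> \<mu> \<boxtimes> \<phi> \<boxtimes> \<phi>) \<bullet> (\<iota> H \<boxtimes> \<beta> H H \<boxtimes> \<iota> H) \<bullet> (\<Delta> \<boxtimes> \<Delta>)"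
    by (simp only: act)
  also have "\<dots> = ?s \<bullet> (adjoint_coaction \<boxtimes> \<phi>) \<bullet> ((\<mu> \<boxtimes> \<mu>) \<bullet> (\<iota> H \<boxtimes> \<beta> H H \<boxtimes> \<iota> H) \<bullet> (\<Delta> \<boxtimes> \<Delta>))"
    by (simp add: cmp_eq_chain[OF e3])
  also have "\<dots> = (?s \<bullet> (adjoint_coaction \<boxtimes> \<phi>) \<bullet> \<Delta>) \<bullet> \<mu>"
    by (simp add: bialgebra)
  finally have l: "?s \<bullet> (?l \<boxtimes> \<phi>) \<bullet> (\<iota> H \<boxtimes> \<Delta>) = \<Delta> \<bullet> \<mu>"
    by (simp only: adjoint_coaction_convolution)
  have "?s \<bullet> (?r \<boxtimes> \<phi>) \<bullet> (\<iota> H \<boxtimes> \<Delta>)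
      = (?s \<bullet> (square_mult \<boxtimes> \<iota> H)) \<bullet> ((\<Delta> \<boxtimes> adjoint_coaction \<boxtimes> \<phi>) \<bullet> (\<iota> H \<boxtimes> \<Delta>))"
    unfolding e2 by simp
  also have "\<dots> = (?s \<bullet> (square_mult \<boxtimes> \<iota> H)) \<bullet> (\<Delta> \<boxtimes> (adjoint_coaction \<boxtimes> \<phi>) \<bullet> \<Delta>)"
    by (simp add: interchange_simps)
  also have "\<dots> = square_mult \<bullet> (\<Delta> \<boxtimes> ?s \<bullet> (adjoint_coaction \<boxtimes> \<phi>) \<bullet> \<Delta>)"
    unfolding shift_act_square_mult by (simp add: interchange_simps)
  also have "\<dots> = \<Delta> \<bullet> \<mu>"
    unfolding adjoint_coaction_convolution by (simp add: square_mult_def bialgebra)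
  finally show "?s \<bullet> (?l \<boxtimes> \<phi>) \<bullet> (\<iota> H \<boxtimes> \<Delta>) = ?s \<bullet> (?r \<boxtimes> \<phi>) \<bullet> (\<iota> H \<boxtimes> \<Delta>)"
    unfolding l by simp
qed simp_all

lemma adjoint_coaction_expand:
  "adjoint_coaction = (\<mu> \<boxtimes> \<iota> H) \<bullet> (\<iota> H \<boxtimes> \<beta> H H) \<bullet> (\<iota> (H \<odot> H) \<boxtimes> S \<bullet> \<phi>) \<bullet> (\<Delta> \<boxtimes> \<iota> H) \<bullet> \<Delta>"
  by (simp add: adjoint_coaction_def shift_act_def interchange_simps)

lemma adjoint_coaction_yetter_drinfeld_expand:
  "(\<mu> \<boxtimes> \<iota> H) \<bullet> (\<iota> H \<boxtimes> \<beta> H H) \<bullet> (adjoint_coaction \<bullet> \<mu> \<boxtimes> \<phi>) \<bullet> (\<iota> H \<boxtimes> \<beta> H H) \<bullet> (\<Delta> \<boxtimes> \<iota> H)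
    = (\<mu> \<boxtimes> \<mu>) \<bullet> (\<iota> H \<boxtimes> \<beta> H H \<boxtimes> \<iota> H) \<bullet> (\<Delta> \<boxtimes> adjoint_coaction)"
  using adjoint_coaction_yetter_drinfeld by (simp add: shift_act_def square_mult_def)

end

section \<open>Back to untyped morphisms\<close>

text \<open>
Compatibility with both the algebra and the coalgebra structure makes this notion self-dual.
\<close>

definition hopf_endomorphism ::
  "('o, 'm) bmcat \<Rightarrow> 'o \<Rightarrow> 'm \<Rightarrow> 'm \<Rightarrow> 'm \<Rightarrow> 'm \<Rightarrow> 'm \<Rightarrow> 'm \<Rightarrow> bool" where
  "hopf_endomorphism D H \<mu> \<eta> \<Delta> \<epsilon> S \<phi> \<longleftrightarrow> \<phi> \<in> Hom D H H \<and>
     \<phi> \<cdot>\<^bsub>D\<^esub> \<mu> = \<mu> \<cdot>\<^bsub>D\<^esub> (\<phi> \<otimes>\<^bsub>D\<^esub> \<phi>) \<and> \<phi> \<cdot>\<^bsub>D\<^esub> \<eta> = \<eta> \<and>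
     \<Delta> \<cdot>\<^bsub>D\<^esub> \<phi> = (\<phi> \<otimes>\<^bsub>D\<^esub> \<phi>) \<cdot>\<^bsub>D\<^esub> \<Delta> \<and> \<epsilon> \<cdot>\<^bsub>D\<^esub> \<phi> = \<epsilon> \<and> \<phi> \<cdot>\<^bsub>D\<^esub> S = S \<cdot>\<^bsub>D\<^esub> \<phi>"

lemma left_yd_adjoint_coaction:
  fixes D :: "('o, 'm) bmcat" (structure)
  assumes D: "strict_braided_monoidal_category D"
    and hopf: "hopf_object D H \<mu> \<eta> \<Delta> \<epsilon> S" and endo: "hopf_endomorphism D H \<mu> \<eta> \<Delta> \<epsilon> S \<phi>"
    and d: "d = (\<mu> \<otimes> \<one> H) \<cdot> (\<one> H \<otimes> \<tau> H H) \<cdot> (\<one> (H \<odot> H) \<otimes> S \<cdot> \<phi>) \<cdot> (\<Delta> \<otimes> \<one> H) \<cdot> \<Delta>"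
  shows "left_comodule D H \<Delta> \<epsilon> H d" and "left_yd_condition D H \<phi> \<mu> \<Delta> H \<mu> d"
proof -
  interpret strict_braided_monoidal_category D by (rule D)
  have H: "H \<in> Ob D" using hopf by (simp add: hopf_object_def algebra_object_def)
  interpret typed_hopf_object D H "Arrow (H \<odot> H) \<mu> H" "Arrow \<I> \<eta> H" "Arrow H \<Delta> (H \<odot> H)"
    "Arrow H \<epsilon> \<I>" "Arrow H S H" "Arrow H \<phi> H"
    using hopf endo H
    by unfold_locales
      (simp_all add: arr_def hopf_object_def algebra_object_def coalgebra_object_def iso_arrow_def
        hopf_endomorphism_def cmp_def ten_def idn_def brd_def tensor_ob_assoc tensor_ob_unit unit_ob)
  have d': "mor adjoint_coaction = d"
    unfolding adjoint_coaction_expand mor_simps arrow.sel d ..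
  have "d \<in> Hom D H (H \<odot> H)"
    using adjoint_coaction_typing unfolding arr_def d'[symmetric] by metis
  then show "left_comodule D H \<Delta> \<epsilon> H d"
    using arg_cong[OF adjoint_coaction_coassoc, of mor] arg_cong[OF adjoint_coaction_counit, of mor] H
    unfolding mor_simps arrow.sel d' left_comodule_def by blast
  show "left_yd_condition D H \<phi> \<mu> \<Delta> H \<mu> d"
    using arg_cong[OF adjoint_coaction_yetter_drinfeld_expand, of mor]
    unfolding mor_simps arrow.sel d' left_yd_condition_def .
qed

section \<open>Duality\<close>

text \<open>
Reversing the tensor product as well as the arrows keeps the braiding: a morphism from \<open>A \<otimes> B\<close> to
\<open>B \<otimes> A\<close> in the dual category is again a morphism from \<open>A \<otimes> B\<close> to \<open>B \<otimes> A\<close> in the original one.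
\<close>

definition dual_cat :: "('o, 'm) bmcat \<Rightarrow> ('o, 'm) bmcat" where
  "dual_cat D = \<lparr>
     Ob = Ob D,
     Hom = (\<lambda>A B. Hom D B A),
     ident = ident D,
     comp = (\<lambda>g f. f \<cdot>\<^bsub>D\<^esub> g),
     unit_ob = \<I>\<^bsub>D\<^esub>,
     tensor_ob = (\<lambda>A B. B \<odot>\<^bsub>D\<^esub> A),
     tensor = (\<lambda>f g. g \<otimes>\<^bsub>D\<^esub> f),
     braiding = braiding D \<rparr>"

context strict_braided_monoidal_category
begin

lemma dual_cat_strict_braided_monoidal: "strict_braided_monoidal_category (dual_cat C)"
proof (unfold_locales, goal_cases)
  case (17 f A A' g B B')
  then show ?case using braiding_natural[of f A' A g B' B] by (simp add: dual_cat_def)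
next
  case (16 A B)
  then show ?case using braiding_iso[of A B] by (auto simp: dual_cat_def iso_arrow_def)
next
  case (11 f A B f' D g A' B' g' D')
  then show ?case using interchange[of g' D' B' g A' f' D B f A] by (simp add: dual_cat_def)
next
  case (14 f A A' g B B' h D D')
  then show ?case using tensor_assoc[of h D' D g B' B f A' A] by (simp add: dual_cat_def)
next
  case (4 h D E g B f A)
  then show ?case using comp_assoc[of f B A g D h E] by (simp add: dual_cat_def)
qed (auto simp: dual_cat_def ident_hom unit_ob tensor_ob tensor_hom tensor_ident tensor_ob_assoc
       tensor_ob_unit tensor_unit hexagon_left hexagon_right ident_left ident_right
       dest: hom_ob intro: comp_hom)

lemma hopf_object_dual:
  assumes "hopf_object C H \<mu> \<eta> \<Delta> \<epsilon> S"
  shows "hopf_object (dual_cat C) H \<Delta> \<epsilon> \<mu> \<eta> S"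
proof -
  note h = assms[unfolded hopf_object_def algebra_object_def coalgebra_object_def]
  have H: "H \<in> Ob C" and m: "\<mu> \<in> Hom C (H \<odot> H) H" and c: "\<Delta> \<in> Hom C H (H \<odot> H)"
    and S: "S \<in> Hom C H H" using h by (auto simp: iso_arrow_def)
  note i = ident_hom[OF H]
  have t: "\<tau> H H \<in> Hom C (H \<odot> H) (H \<odot> H)"
    using braiding_iso[OF H H] by (simp add: iso_arrow_def)
  have "((\<mu> \<otimes> \<mu>) \<cdot> ((\<one> H \<otimes> \<tau> H H) \<otimes> \<one> H)) \<cdot> (\<Delta> \<otimes> \<Delta>) = \<Delta> \<cdot> \<mu>"
  proof -
    have "\<mu> \<otimes> \<mu> \<in> Hom C (H \<odot> H \<odot> H \<odot> H) (H \<odot> H)"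
      "\<Delta> \<otimes> \<Delta> \<in> Hom C (H \<odot> H) (H \<odot> H \<odot> H \<odot> H)"
      "\<one> H \<otimes> \<tau> H H \<otimes> \<one> H \<in> Hom C (H \<odot> H \<odot> H \<odot> H) (H \<odot> H \<odot> H \<odot> H)"
      using tensor_hom[OF m m] tensor_hom[OF c c] tensor_hom[OF i tensor_hom[OF t i]] H
      by (simp_all add: tensor_ob_assoc tensor_ob)
    from comp_assoc[OF this(1,3,2)] tensor_assoc[OF i t i] show ?thesis using h by simp
  qed
  moreover have "(\<mu> \<cdot> (\<one> H \<otimes> S)) \<cdot> \<Delta> = \<eta> \<cdot> \<epsilon>" "(\<mu> \<cdot> (S \<otimes> \<one> H)) \<cdot> \<Delta> = \<eta> \<cdot> \<epsilon>"
    using h comp_assoc[OF m tensor_hom[OF i S] c] comp_assoc[OF m tensor_hom[OF S i] c]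
    by simp_all
  ultimately show ?thesis
    using h by (auto simp: hopf_object_def algebra_object_def coalgebra_object_def dual_cat_def
        iso_arrow_def)
qed

lemma hopf_endomorphism_dual:
  "hopf_endomorphism C H \<mu> \<eta> \<Delta> \<epsilon> S \<phi> \<Longrightarrow> hopf_endomorphism (dual_cat C) H \<Delta> \<epsilon> \<mu> \<eta> S \<phi>"
  by (simp add: hopf_endomorphism_def dual_cat_def)

lemma comp_assoc_four:
  assumes "k \<in> Hom C D E" "h \<in> Hom C B D" "g \<in> Hom C A B" "f \<in> Hom C X A"
  shows "((k \<cdot> h) \<cdot> g) \<cdot> f = k \<cdot> h \<cdot> g \<cdot> f"
  using comp_assoc[OF comp_hom[OF assms(1,2)] assms(3,4)] comp_assoc[OF assms(1,2) comp_hom[OF assms(3,4)]]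
  by simp

text \<open>
Up to the bracketing of composites, the arrow \<open>r\<close> is the adjoint coaction \<open>\<delta>\<close> of the dual Hopf object
in \<open>dual_cat C\<close>, a right module over \<open>H\<close> is a left comodule over the dual Hopf object, and the right
Yetter--Drinfel'd condition is the left one.
\<close>

lemma right_yd_adjoint_action:
  assumes hopf: "hopf_object C H \<mu> \<eta> \<Delta> \<epsilon> S" and endo: "hopf_endomorphism C H \<mu> \<eta> \<Delta> \<epsilon> S \<phi>"
    and r: "r = (\<mu> \<cdot> (\<mu> \<otimes> \<one> H)) \<cdot> (S \<cdot> \<phi> \<otimes> \<one> (H \<odot> H)) \<cdot> (\<tau> H H \<otimes> \<one> H) \<cdot> (\<one> H \<otimes> \<Delta>)"
  shows "right_module C H \<mu> \<eta> H r" and "right_yd_condition C H \<phi> \<mu> \<Delta> H r \<Delta>"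
proof -
  note h = hopf[unfolded hopf_object_def algebra_object_def coalgebra_object_def]
  note e = endo[unfolded hopf_endomorphism_def]
  have H: "H \<in> Ob C" and m: "\<mu> \<in> Hom C (H \<odot> H) H" and c: "\<Delta> \<in> Hom C H (H \<odot> H)"
    and S: "S \<in> Hom C H H" using h by (auto simp: iso_arrow_def)
  have p: "\<phi> \<in> Hom C H H" using e by simp
  note i = ident_hom[OF H] and HH = tensor_ob[OF H H]
  note ii = ident_hom[OF HH] and Sp = comp_hom[OF S p]
  have t: "\<tau> H H \<in> Hom C (H \<odot> H) (H \<odot> H)"
    using braiding_iso[OF H H] by (simp add: iso_arrow_def)
  let ?H3 = "H \<odot> H \<odot> H"
  have mt: "\<one> H \<otimes> \<mu> \<in> Hom C ?H3 (H \<odot> H)" and mt': "\<mu> \<otimes> \<one> H \<in> Hom C ?H3 (H \<odot> H)"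
    and ct: "\<one> H \<otimes> \<Delta> \<in> Hom C (H \<odot> H) ?H3"
    and tt: "\<tau> H H \<otimes> \<one> H \<in> Hom C ?H3 ?H3"
    and St: "S \<cdot> \<phi> \<otimes> \<one> (H \<odot> H) \<in> Hom C ?H3 ?H3"
    using tensor_hom[OF i m] tensor_hom[OF m i] tensor_hom[OF i c] tensor_hom[OF t i]
      tensor_hom[OF Sp ii] H by (simp_all add: tensor_ob_assoc tensor_ob)
  have ps: "\<phi> \<cdot> S = S \<cdot> \<phi>" using e by simp
  have m2: "\<mu> \<cdot> (\<mu> \<otimes> \<one> H) = \<mu> \<cdot> (\<one> H \<otimes> \<mu>)" using h by blast
  have r': "r = (((\<mu> \<cdot> (\<one> H \<otimes> \<mu>)) \<cdot> (\<phi> \<cdot> S \<otimes> \<one> (H \<odot> H))) \<cdot> (\<tau> H H \<otimes> \<one> H)) \<cdot> (\<one> H \<otimes> \<Delta>)"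
    using comp_assoc_four[OF comp_hom[OF m mt] St tt ct] unfolding r m2 ps by simp
  have rt: "r \<in> Hom C (H \<odot> H) H"
    unfolding r by (intro comp_hom[OF comp_hom[OF m mt']] comp_hom[OF St] comp_hom[OF tt] ct)
  note left = left_yd_adjoint_coaction[OF dual_cat_strict_braided_monoidal hopf_object_dual[OF hopf]
      hopf_endomorphism_dual[OF endo], of r]
  \<comment> \<open>The left adjoint coaction of the dual Hopf object.\<close>
  have d: "r = (\<Delta> \<otimes>\<^bsub>dual_cat C\<^esub> \<one>\<^bsub>dual_cat C\<^esub> H) \<cdot>\<^bsub>dual_cat C\<^esub> (\<one>\<^bsub>dual_cat C\<^esub> H \<otimes>\<^bsub>dual_cat C\<^esub> \<tau>\<^bsub>dual_cat C\<^esub> H H)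
      \<cdot>\<^bsub>dual_cat C\<^esub> (\<one>\<^bsub>dual_cat C\<^esub> (H \<odot>\<^bsub>dual_cat C\<^esub> H) \<otimes>\<^bsub>dual_cat C\<^esub> S \<cdot>\<^bsub>dual_cat C\<^esub> \<phi>)
      \<cdot>\<^bsub>dual_cat C\<^esub> (\<mu> \<otimes>\<^bsub>dual_cat C\<^esub> \<one>\<^bsub>dual_cat C\<^esub> H) \<cdot>\<^bsub>dual_cat C\<^esub> \<mu>"
    by (simp add: dual_cat_def r')
  show "right_module C H \<mu> \<eta> H r"
    using left(1)[OF d] by (simp add: left_comodule_def right_module_def dual_cat_def)
  have pt: "\<phi> \<otimes> \<Delta> \<cdot> r \<in> Hom C ?H3 ?H3"
    using tensor_hom[OF p comp_hom[OF c rt]] by simp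
  have cc: "\<Delta> \<otimes> \<Delta> \<in> Hom C (H \<odot> H) (H \<odot> H \<odot> H \<odot> H)"
    and itt: "\<one> H \<otimes> \<tau> H H \<otimes> \<one> H \<in> Hom C (H \<odot> H \<odot> H \<odot> H) (H \<odot> H \<odot> H \<odot> H)"
    and rm: "r \<otimes> \<mu> \<in> Hom C (H \<odot> H \<odot> H \<odot> H) (H \<odot> H)"
    using tensor_hom[OF rt m] tensor_hom[OF c c] tensor_hom[OF i tensor_hom[OF t i]] H
    by (simp_all add: tensor_ob_assoc tensor_ob)
  have "((((\<one> H \<otimes> \<mu>) \<cdot> (\<tau> H H \<otimes> \<one> H)) \<cdot> (\<phi> \<otimes> \<Delta> \<cdot> r)) \<cdot> (\<tau> H H \<otimes> \<one> H)) \<cdot> (\<one> H \<otimes> \<Delta>)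
      = ((r \<otimes> \<mu>) \<cdot> ((\<one> H \<otimes> \<tau> H H) \<otimes> \<one> H)) \<cdot> (\<Delta> \<otimes> \<Delta>)"
    using left(2)[OF d] by (simp add: left_yd_condition_def dual_cat_def)
  then show "right_yd_condition C H \<phi> \<mu> \<Delta> H r \<Delta>"
    using comp_assoc_four[OF comp_hom[OF mt tt] pt tt ct] comp_assoc[OF rm itt cc]
      comp_assoc[OF mt tt comp_hom[OF pt comp_hom[OF tt ct]]] tensor_assoc[OF i t i]
    by (simp add: right_yd_condition_def)
qed

section \<open>The f-object case\<close>

text \<open>
Each compatibility is the naturality square of a structure morphism at the generator \<open>1\<close> of \<open>\<int>\<close>;
\<open>\<phi>\<close> itself is natural because \<open>\<int>\<close> is commutative.
\<close>

lemma f_aut_hopf_endomorphism: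
  assumes "hopf_f_object C H \<mu> \<eta> \<Delta> \<epsilon> S"
  shows "hopf_endomorphism (f_cat C) H \<mu> \<eta> \<Delta> \<epsilon> S (f_aut H)"
proof -
  have hom: "\<mu> \<in> Hom D (H \<odot>\<^bsub>D\<^esub> H) H" "\<eta> \<in> Hom D \<I>\<^bsub>D\<^esub> H" "\<Delta> \<in> Hom D H (H \<odot>\<^bsub>D\<^esub> H)"
      "\<epsilon> \<in> Hom D H \<I>\<^bsub>D\<^esub>" "S \<in> Hom D H H" and H: "H \<in> Ob D"
    if "D = f_cat C" for D
    using assms unfolding that hopf_f_object_def hopf_object_def algebra_object_def
      coalgebra_object_def iso_arrow_def by blast+
  have nat: "snd G n \<cdot> f = f \<cdot> snd F n" if "f \<in> Hom (f_cat C) F G" for f F G n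
    using that by (simp add: f_cat_def)
  have HF: "is_Z_functor C H"
    using H by (simp add: f_cat_def)
  have "snd H n \<cdot> snd H 1 = snd H 1 \<cdot> snd H n" for n
    using HF unfolding is_Z_functor_def by (metis add.commute)
  then have p: "f_aut H \<in> Hom (f_cat C) H H"
    using HF by (simp add: f_cat_def f_aut_def is_Z_functor_def)
  have u: "\<eta> \<in> Hom C \<I> (fst H)" "\<epsilon> \<in> Hom C (fst H) \<I>"
    using hom(2,4)[OF refl] by (simp_all add: f_cat_def)
  show ?thesis
    using nat[OF hom(1)[OF refl], of 1] nat[OF hom(2)[OF refl], of 1] nat[OF hom(3)[OF refl], of 1]
      nat[OF hom(4)[OF refl], of 1] nat[OF hom(5)[OF refl], of 1] p
      ident_left[OF u(2)] ident_right[OF u(1)]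
    unfolding hopf_endomorphism_def by (simp add: f_cat_def f_aut_def)
qed

end

theorem theorem3p5:
  fixes C :: "('o, 'm) bmcat"
    and D :: "(('o, 'm) Z_functor, 'm) bmcat" (structure)
    and H :: "('o, 'm) Z_functor"
    and \<mu> \<eta> \<Delta> \<epsilon> S \<phi> \<mu>\<^sub>2 \<Delta>\<^sub>2 \<delta>\<^sub>L \<rho>\<^sub>R :: 'm
  assumes "strict_braided_monoidal_category C"
    and "hopf_f_object C H \<mu> \<eta> \<Delta> \<epsilon> S"
    and "D = f_cat C"
    and "\<phi> = f_aut H"
    and "\<mu>\<^sub>2 = \<mu> \<cdot> (\<mu> \<otimes> \<one> H)"
    and "\<Delta>\<^sub>2 = (\<Delta> \<otimes> \<one> H) \<cdot> \<Delta>"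
    and "\<delta>\<^sub>L = (\<mu> \<otimes> \<one> H) \<cdot> (\<one> H \<otimes> \<tau> H H) \<cdot> (\<one> (H \<odot> H) \<otimes> S \<cdot> \<phi>) \<cdot> \<Delta>\<^sub>2"
    and "\<rho>\<^sub>R = \<mu>\<^sub>2 \<cdot> (S \<cdot> \<phi> \<otimes> \<one> (H \<odot> H)) \<cdot> (\<tau> H H \<otimes> \<one> H) \<cdot> (\<one> H \<otimes> \<Delta>)"
  shows "left_yd_f_object C H \<mu> \<eta> \<Delta> \<epsilon> H \<mu> \<delta>\<^sub>L \<and>
         right_yd_f_object C H \<mu> \<eta> \<Delta> \<epsilon> H \<rho>\<^sub>R \<Delta>"
proof -
  interpret C: strict_braided_monoidal_category C by (rule assms(1))
  interpret D: strict_braided_monoidal_category D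
    unfolding assms(3) by (rule C.f_cat_strict_braided_monoidal)
  have hopf: "hopf_object D H \<mu> \<eta> \<Delta> \<epsilon> S"
    using assms(2,3) by (simp add: hopf_f_object_def)
  have endo: "hopf_endomorphism D H \<mu> \<eta> \<Delta> \<epsilon> S \<phi>"
    unfolding assms(3,4) by (rule C.f_aut_hopf_endomorphism[OF assms(2)])
  have "left_module D H \<mu> \<eta> H \<mu>" "right_comodule D H \<Delta> \<epsilon> H \<Delta>"
    using hopf by (simp_all add: left_module_def right_comodule_def hopf_object_def
        algebra_object_def coalgebra_object_def)
  then show ?thesis
    using left_yd_adjoint_coaction[OF D.strict_braided_monoidal_category_axioms hopf endo assms(7)[unfolded assms(6)]]
      D.right_yd_adjoint_action[OF hopf endo assms(8)[unfolded assms(5)]]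
    unfolding left_yd_f_object_def right_yd_f_object_def assms(3,4) by blast
qed

end
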